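(* Let $D$ be an $L$-regular linear connection on $M$, and let $G$ and $H$ be the vector $1$-forms on $M$ defined by $$G(LX)=-hX,\quad G(hX)=LX,\qquad H(LX)=hX,\quad H(hX)=LX\qquad\text{for all }X\in\mathfrak X(M).$$ Then to $D$ there is associated a unique $L$-connection $\Gamma$ on $M$ given by $\Gamma=HG$ (that is, the vector $1$-form $HG$ satisfies $L(HG)=L$ and $(HG)L=-L$).
   Context: Everything is $C^\infty$. $M$ is a manifold of dimension $2n$ and $\mathfrak X(M)$ is its Lie algebra of vector fields. A vector $1$-form is a field of endomorphisms of $TM$; brackets of vector forms are Fr\"olicher--Nijenhuis brackets; for a vector field $X$ and a vector $1$-form $K$, $[X,K]Y=[X,KY]-K[X,Y]$. $L$ is a fixed vector $1$-form on $M$ of constant rank $n$ with $[L,L]=0$ and $\mathrm{Im}(L_z)=\mathrm{Ker}(L_z)$ for all $z\in M$ (so $L^2=0$). The vertical bundle is $V(M)=\mathrm{Im}\,L=\mathrm{Ker}\,L$. $C$ denotes the canonical vector field: a fixed vertical vector field on $M$ with $[C,L]=-L$. A linear connection $D$ on $M$ is $L$-almost-tangent if $D_X(LY)=L(D_XY)$ for all $X,Y\in\mathfrak X(M)$. Its connection map is the vector $1$-form $K(X)=D_XC$. $D$ is $L$-regular if it is $L$-almost-tangent and $X\mapsto K(X)$ restricts to an isomorphism $V(M)\to V(M)$; the inverse of this restriction is denoted $\varphi$. For an $L$-regular $D$ the vertical and horizontal projectors are $v=\varphi\circ K$ and $h=I-\varphi\circ K$, and $TM=V(M)\oplus H(M)$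 with $H(M)=\mathrm{Im}\,h$. An $L$-connection on $M$ is a vector $1$-form $\Gamma$ on $M$ with $L\Gamma=L$ and $\Gamma L=-L$. *)

theory Defs
  imports "HOL-Analysis.Analysis" "HOL-Library.Function_Algebras"
begin

subsection \<open>Pointwise vector space structure on functions\<close>

instantiation "fun" :: (type, real_vector) real_vector
begin

definition scaleR_fun :: "real \<Rightarrow> ('a \<Rightarrow> 'b) \<Rightarrow> 'a \<Rightarrow> 'b" where
  "scaleR_fun c f = (\<lambda>x. c *\<^sub>R f x)"

instance
  by standard (auto simp: scaleR_fun_def fun_eq_iff scaleR_add_right scaleR_add_left)

end


subsection \<open>Smooth manifolds\<close>

text \<open>Continuity of all iterated directional derivatives up to order \<open>k\<close>; this is only used on
  open sets of a Euclidean space, where it is the usual class \<open>C\<close> of order \<open>k\<close>.\<close>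

fun Ck_on :: "nat \<Rightarrow> 'a set \<Rightarrow> ('a::real_normed_vector \<Rightarrow> 'b::real_normed_vector) \<Rightarrow> bool" where
  "Ck_on 0 S f \<longleftrightarrow> continuous_on S f"
| "Ck_on (Suc k) S f \<longleftrightarrow>
     (\<forall>x\<in>S. f differentiable (at x)) \<and>
     (\<forall>v. Ck_on k S (\<lambda>x. frechet_derivative f (at x) v))"

definition smooth_on :: "'a set \<Rightarrow> ('a::real_normed_vector \<Rightarrow> 'b::real_normed_vector) \<Rightarrow> bool" where
  "smooth_on S f \<longleftrightarrow> (\<forall>k. Ck_on k S f)"

text \<open>The manifold is the whole type \<open>'m\<close>; its smooth structure is given by an atlas, a set of
  charts \<open>(U, \<phi>)\<close> of which only the values of \<open>\<phi>\<close> on \<open>U\<close> matter. The manifold is Hausdorff and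
  second countable through the type class constraint, and its dimension is \<open>DIM('e)\<close>.\<close>

type_synonym ('m, 'e) atlas = "('m set \<times> ('m \<Rightarrow> 'e)) set"

definition smooth_manifold ::
  "('m::{t2_space, second_countable_topology}, 'e::euclidean_space) atlas \<Rightarrow> bool" where
  "smooth_manifold A \<longleftrightarrow>
     (\<Union>(U, \<phi>)\<in>A. U) = UNIV \<and>
     (\<forall>(U, \<phi>)\<in>A. open U \<and> open (\<phi> ` U) \<and> homeomorphism U (\<phi> ` U) \<phi> (inv_into U \<phi>)) \<and>
     (\<forall>(U, \<phi>)\<in>A. \<forall>(V, \<psi>)\<in>A. smooth_on (\<phi> ` (U \<inter> V)) (\<psi> \<circ> inv_into U \<phi>))"

definition smooth_functions :: "('m, 'e::euclidean_space) atlas \<Rightarrow> ('m \<Rightarrow> real) set" where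
  "smooth_functions A = {f. \<forall>(U, \<phi>)\<in>A. smooth_on (\<phi> ` U) (f \<circ> inv_into U \<phi>)}"


subsection \<open>Tangent vectors and vector fields\<close>

text \<open>Tangent vectors at \<open>z\<close> are the derivations at \<open>z\<close> of the algebra of smooth functions. As HOL
  functions are total, they are extended by \<open>0\<close> to non-smooth functions, so that
  equality of tangent vectors is equality of functions.\<close>

type_synonym 'm tvec = "('m \<Rightarrow> real) \<Rightarrow> real"

definition tangent_space :: "('m, 'e::euclidean_space) atlas \<Rightarrow> 'm \<Rightarrow> 'm tvec set" where
  "tangent_space A z = {u.
     (\<forall>f\<in>smooth_functions A. \<forall>g\<in>smooth_functions A.
        u (\<lambda>x. f x + g x) = u f + u g \<and>
        u (\<lambda>x. f x * g x) = f z * u g + g z * u f) \<and>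
     (\<forall>c. \<forall>f\<in>smooth_functions A. u (\<lambda>x. c * f x) = c * u f) \<and>
     (\<forall>f. f \<notin> smooth_functions A \<longrightarrow> u f = 0)}"

type_synonym 'm field = "'m \<Rightarrow> 'm tvec"

definition vector_fields :: "('m, 'e::euclidean_space) atlas \<Rightarrow> 'm field set" where
  "vector_fields A = {X. (\<forall>z. X z \<in> tangent_space A z) \<and>
     (\<forall>f\<in>smooth_functions A. (\<lambda>z. X z f) \<in> smooth_functions A)}"

definition fun_mult :: "('m \<Rightarrow> real) \<Rightarrow> 'm field \<Rightarrow> 'm field" where
  "fun_mult f X = (\<lambda>z. f z *\<^sub>R X z)"

definition lie_bracket :: "'m field \<Rightarrow> 'm field \<Rightarrow> 'm field" where
  "lie_bracket X Y = (\<lambda>z f. X z (\<lambda>w. Y w f) - Y z (\<lambda>w. X w f))"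


subsection \<open>Vector 1-forms\<close>

text \<open>A vector 1-form is a field of linear endomorphisms \<open>K z\<close> of the tangent spaces, smooth in the
  sense that it maps smooth vector fields to smooth vector fields. Off the tangent space
  \<open>K z\<close> is set to \<open>0\<close>, so that equality of vector 1-forms is equality of functions.\<close>

type_synonym 'm form1 = "'m \<Rightarrow> 'm tvec \<Rightarrow> 'm tvec"

definition form_app :: "'m form1 \<Rightarrow> 'm field \<Rightarrow> 'm field" (infixr "\<cdot>" 80) where
  "K \<cdot> X = (\<lambda>z. K z (X z))"

definition form_comp :: "'m form1 \<Rightarrow> 'm form1 \<Rightarrow> 'm form1" (infixl "\<odot>" 75) where
  "K \<odot> L = (\<lambda>z u. K z (L z u))"

definition vector_one_form :: "('m, 'e::euclidean_space) atlas \<Rightarrow> 'm form1 \<Rightarrow> bool" where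
  "vector_one_form A K \<longleftrightarrow>
     (\<forall>z. \<forall>u\<in>tangent_space A z. K z u \<in> tangent_space A z \<and>
        (\<forall>w\<in>tangent_space A z. K z (u + w) = K z u + K z w) \<and>
        (\<forall>c. K z (c *\<^sub>R u) = c *\<^sub>R K z u)) \<and>
     (\<forall>z u. u \<notin> tangent_space A z \<longrightarrow> K z u = 0) \<and>
     (\<forall>X\<in>vector_fields A. K \<cdot> X \<in> vector_fields A)"

definition bracket_field_form :: "'m field \<Rightarrow> 'm form1 \<Rightarrow> 'm field \<Rightarrow> 'm field" where
  "bracket_field_form X K Y = lie_bracket X (K \<cdot> Y) - K \<cdot> lie_bracket X Y"

text \<open>The Froelicher-Nijenhuis bracket \<open>[K, L]\<close> of two vector 1-forms, evaluated on \<open>(X, Y)\<close>.\<close>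

definition bracket_form_form :: "'m form1 \<Rightarrow> 'm form1 \<Rightarrow> 'm field \<Rightarrow> 'm field \<Rightarrow> 'm field" where
  "bracket_form_form K L X Y =
     lie_bracket (K \<cdot> X) (L \<cdot> Y) + lie_bracket (L \<cdot> X) (K \<cdot> Y)
     + K \<cdot> L \<cdot> lie_bracket X Y + L \<cdot> K \<cdot> lie_bracket X Y
     - K \<cdot> lie_bracket (L \<cdot> X) Y - K \<cdot> lie_bracket X (L \<cdot> Y)
     - L \<cdot> lie_bracket (K \<cdot> X) Y - L \<cdot> lie_bracket X (K \<cdot> Y)"

definition im_at :: "('m, 'e::euclidean_space) atlas \<Rightarrow> 'm form1 \<Rightarrow> 'm \<Rightarrow> 'm tvec set" where
  "im_at A K z = K z ` tangent_space A z"

definition ker_at :: "('m, 'e::euclidean_space) atlas \<Rightarrow> 'm form1 \<Rightarrow> 'm \<Rightarrow> 'm tvec set" where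
  "ker_at A K z = {u \<in> tangent_space A z. K z u = 0}"


subsection \<open>The structure \<open>L\<close> and the canonical field\<close>

definition almost_tangent_structure ::
  "('m, 'e::euclidean_space) atlas \<Rightarrow> nat \<Rightarrow> 'm form1 \<Rightarrow> bool" where
  "almost_tangent_structure A n L \<longleftrightarrow>
     vector_one_form A L \<and>
     (\<forall>z. dim (im_at A L z) = n) \<and>
     (\<forall>X\<in>vector_fields A. \<forall>Y\<in>vector_fields A. bracket_form_form L L X Y = 0) \<and>
     (\<forall>z. im_at A L z = ker_at A L z)"

abbreviation vertical_space ::
  "('m, 'e::euclidean_space) atlas \<Rightarrow> 'm form1 \<Rightarrow> 'm \<Rightarrow> 'm tvec set" where
  "vertical_space \<equiv> im_at"

definition canonical_field ::
  "('m, 'e::euclidean_space) atlas \<Rightarrow> 'm form1 \<Rightarrow> 'm field \<Rightarrow> bool" where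
  "canonical_field A L C \<longleftrightarrow>
     C \<in> vector_fields A \<and> (\<forall>z. C z \<in> vertical_space A L z) \<and>
     (\<forall>Y\<in>vector_fields A. bracket_field_form C L Y = - (L \<cdot> Y))"


subsection \<open>Linear connections\<close>

definition linear_connection ::
  "('m, 'e::euclidean_space) atlas \<Rightarrow> ('m field \<Rightarrow> 'm field \<Rightarrow> 'm field) \<Rightarrow> bool" where
  "linear_connection A D \<longleftrightarrow>
     (\<forall>X\<in>vector_fields A. \<forall>Y\<in>vector_fields A. D X Y \<in> vector_fields A) \<and>
     (\<forall>X\<in>vector_fields A. \<forall>X'\<in>vector_fields A. \<forall>Y\<in>vector_fields A.
        D (X + X') Y = D X Y + D X' Y) \<and>
     (\<forall>f\<in>smooth_functions A. \<forall>X\<in>vector_fields A. \<forall>Y\<in>vector_fields A.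
        D (fun_mult f X) Y = fun_mult f (D X Y)) \<and>
     (\<forall>X\<in>vector_fields A. \<forall>Y\<in>vector_fields A. \<forall>Y'\<in>vector_fields A.
        D X (Y + Y') = D X Y + D X Y') \<and>
     (\<forall>f\<in>smooth_functions A. \<forall>X\<in>vector_fields A. \<forall>Y\<in>vector_fields A.
        D X (fun_mult f Y) = fun_mult (\<lambda>z. X z f) Y + fun_mult f (D X Y))"

definition L_almost_tangent ::
  "('m, 'e::euclidean_space) atlas \<Rightarrow> 'm form1 \<Rightarrow> ('m field \<Rightarrow> 'm field \<Rightarrow> 'm field) \<Rightarrow> bool" where
  "L_almost_tangent A L D \<longleftrightarrow> linear_connection A D \<and>
     (\<forall>X\<in>vector_fields A. \<forall>Y\<in>vector_fields A. D X (L \<cdot> Y) = L \<cdot> D X Y)"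

text \<open>As \<open>D X C\<close> is function-linear in \<open>X\<close>, it is given by exactly one vector 1-form.\<close>

definition connection_map ::
  "('m, 'e::euclidean_space) atlas \<Rightarrow> 'm field \<Rightarrow> ('m field \<Rightarrow> 'm field \<Rightarrow> 'm field) \<Rightarrow> 'm form1" where
  "connection_map A C D =
     (THE K. vector_one_form A K \<and> (\<forall>X\<in>vector_fields A. K \<cdot> X = D X C))"

text \<open>An isomorphism of the vertical bundle is a fibrewise bijection, the
  connection map being fibrewise linear and smooth already.\<close>

definition L_regular ::
  "('m, 'e::euclidean_space) atlas \<Rightarrow> 'm form1 \<Rightarrow> 'm field \<Rightarrow>
   ('m field \<Rightarrow> 'm field \<Rightarrow> 'm field) \<Rightarrow> bool" where
  "L_regular A L C D \<longleftrightarrow> L_almost_tangent A L D \<and>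
     (\<forall>z. bij_betw (connection_map A C D z) (vertical_space A L z) (vertical_space A L z))"

definition phi_map ::
  "('m, 'e::euclidean_space) atlas \<Rightarrow> 'm form1 \<Rightarrow> 'm field \<Rightarrow>
   ('m field \<Rightarrow> 'm field \<Rightarrow> 'm field) \<Rightarrow> 'm form1" where
  "phi_map A L C D = (\<lambda>z. inv_into (vertical_space A L z) (connection_map A C D z))"

definition vertical_projector ::
  "('m, 'e::euclidean_space) atlas \<Rightarrow> 'm form1 \<Rightarrow> 'm field \<Rightarrow>
   ('m field \<Rightarrow> 'm field \<Rightarrow> 'm field) \<Rightarrow> 'm form1" where
  "vertical_projector A L C D = phi_map A L C D \<odot> connection_map A C D"

definition horizontal_projector ::
  "('m, 'e::euclidean_space) atlas \<Rightarrow> 'm form1 \<Rightarrow> 'm field \<Rightarrow>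
   ('m field \<Rightarrow> 'm field \<Rightarrow> 'm field) \<Rightarrow> 'm form1" where
  "horizontal_projector A L C D = (\<lambda>z u. u - vertical_projector A L C D z u)"


subsection \<open>\<open>L\<close>-connections and the vector 1-forms \<open>G\<close> and \<open>H\<close>\<close>

definition L_connection ::
  "('m, 'e::euclidean_space) atlas \<Rightarrow> 'm form1 \<Rightarrow> 'm form1 \<Rightarrow> bool" where
  "L_connection A L \<Gamma> \<longleftrightarrow> vector_one_form A \<Gamma> \<and> L \<odot> \<Gamma> = L \<and> \<Gamma> \<odot> L = - L"

definition is_G ::
  "('m, 'e::euclidean_space) atlas \<Rightarrow> 'm form1 \<Rightarrow> 'm field \<Rightarrow>
   ('m field \<Rightarrow> 'm field \<Rightarrow> 'm field) \<Rightarrow> 'm form1 \<Rightarrow> bool" where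
  "is_G A L C D G \<longleftrightarrow> (let h = horizontal_projector A L C D in
     vector_one_form A G \<and>
     (\<forall>X\<in>vector_fields A. G \<cdot> L \<cdot> X = - (h \<cdot> X) \<and> G \<cdot> h \<cdot> X = L \<cdot> X))"

definition is_H ::
  "('m, 'e::euclidean_space) atlas \<Rightarrow> 'm form1 \<Rightarrow> 'm field \<Rightarrow>
   ('m field \<Rightarrow> 'm field \<Rightarrow> 'm field) \<Rightarrow> 'm form1 \<Rightarrow> bool" where
  "is_H A L C D H \<longleftrightarrow> (let h = horizontal_projector A L C D in
     vector_one_form A H \<and>
     (\<forall>X\<in>vector_fields A. H \<cdot> L \<cdot> X = h \<cdot> X \<and> H \<cdot> h \<cdot> X = L \<cdot> X))"

end

theory Submission
  imports Defs
begin

text \<open>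
  The connection map \<open>K\<close> takes values in the vertical bundle \<open>V\<close>, so \<open>v\<close> and \<open>h\<close> are complementary
  projectors and \<open>TM\<close> is pointwise the sum of the images of \<open>L\<close> and \<open>h\<close>. Hence a vector 1-form is
  determined by its values on \<open>L X\<close> and \<open>h X\<close>, and \<open>H G\<close> is \<open>- id\<close> on the first summand and \<open>id\<close> on
  the second.

  The real work is smoothness. A vertical field is locally \<open>N X\<close> with smooth \<open>X\<close> for every vector
  1-form \<open>N\<close> with image and kernel \<open>V\<close>: if \<open>N F\<^sub>1, \<dots>, N F\<^sub>n\<close> span \<open>V\<close> at a point, then
  \<open>F\<^sub>1, \<dots>, F\<^sub>n, N F\<^sub>1, \<dots>, N F\<^sub>n\<close> is a local frame, and smoothness of coefficients in it follows from
  Steinitz exchange with the coordinate frame over the local ring of germs of smooth functions. Applied to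
  \<open>N = K L\<close> this makes \<open>v\<close> smooth, and applied to \<open>N = L\<close> it makes the form \<open>J\<close> with \<open>J (L X) = h X\<close>,
  \<open>J (h X) = 0\<close> smooth; then \<open>G = L - J\<close> and \<open>H = L + J\<close>.
\<close>

subsection \<open>Smooth functions on open sets\<close>

lemma Ck_on_mono: "Ck_on k S f \<Longrightarrow> W \<subseteq> S \<Longrightarrow> Ck_on k W f"
proof (induction k arbitrary: f)
  case 0
  then show ?case by (auto intro: continuous_on_subset)
next
  case (Suc k)
  then show ?case by auto
qed

text \<open>Since \<open>Ck_on\<close> uses derivatives \<open>at x\<close> rather than within
  \<open>S\<close>, openness of \<open>S\<close> is what carries agreement of values over to
  agreement of derivatives.\<close>

lemma Ck_on_cong:
  assumes "open S" "\<And>x. x \<in> S \<Longrightarrow> f x = g x" "Ck_on k S f"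
  shows "Ck_on k S g"
  using assms(2,3)
proof (induction k arbitrary: f g)
  case 0
  then show ?case using continuous_on_cong[of S S f g] by auto
next
  case (Suc k)
  have d: "(g has_derivative frechet_derivative f (at x)) (at x)" if "x \<in> S" for x
    using has_derivative_transform_within_open[of f "frechet_derivative f (at x)" x UNIV S g]
      Suc.prems that assms(1) frechet_derivative_works[of f "at x"] by auto
  have "Ck_on k S (\<lambda>x. frechet_derivative g (at x) v)" for v
  proof (rule Suc.IH)
    show "frechet_derivative f (at x) v = frechet_derivative g (at x) v" if "x \<in> S" for x
      using frechet_derivative_at[OF d[OF that]] by simp
    show "Ck_on k S (\<lambda>x. frechet_derivative f (at x) v)" using Suc.prems by simp
  qed
  then show ?case using d by (auto simp: differentiable_def)
qed

lemma Ck_on_SucI: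
  assumes "open S" "\<And>x. x \<in> S \<Longrightarrow> (f has_derivative f' x) (at x)"
    and "\<And>v. Ck_on k S (\<lambda>x. f' x v)"
  shows "Ck_on (Suc k) S f"
proof -
  have "Ck_on k S (\<lambda>x. frechet_derivative f (at x) v)" for v
    by (rule Ck_on_cong[OF assms(1) _ assms(3)[of v]]) (metis assms(2) frechet_derivative_at)
  then show ?thesis using assms(2) by (auto simp: differentiable_def)
qed

lemma Ck_on_Suc_has_derivative:
  "Ck_on (Suc k) S f \<Longrightarrow> x \<in> S \<Longrightarrow> (f has_derivative frechet_derivative f (at x)) (at x)"
  using frechet_derivative_works by auto

lemma Ck_on_Suc_imp: "Ck_on (Suc k) S f \<Longrightarrow> Ck_on k S f"
proof (induction k arbitrary: f)
  case 0
  then show ?case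
    by (auto intro!: differentiable_imp_continuous_on
        simp: differentiable_on_def differentiable_at_withinI)
next
  case (Suc k)
  then show ?case by (metis Ck_on.simps(2))
qed

text \<open>Every clause of \<open>Ck_on\<close> is a condition at single points. This allows
  smoothness on a manifold to be checked with a different formula near each point.\<close>

lemma Ck_on_local:
  assumes "\<And>x. x \<in> S \<Longrightarrow> \<exists>W. open W \<and> x \<in> W \<and> Ck_on k W f"
  shows "Ck_on k S f"
  using assms
proof (induction k arbitrary: f)
  case 0
  show ?case unfolding Ck_on.simps
  proof (rule continuous_at_imp_continuous_on, rule ballI)
    fix x assume "x \<in> S"
    then obtain W where "open W" "x \<in> W" "continuous_on W f" using 0 by auto
    then show "isCont f x" using continuous_on_eq_continuous_at by blast
  qed
next
  case (Suc k)
  have "Ck_on k S (\<lambda>x. frechet_derivative f (at x) v)" for v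
    by (rule Suc.IH) (metis Ck_on.simps(2) Suc.prems)
  moreover have "f differentiable (at x)" if "x \<in> S" for x
    by (metis Ck_on.simps(2) Suc.prems that)
  ultimately show ?case by simp
qed

lemma Ck_on_const: "open S \<Longrightarrow> Ck_on k S (\<lambda>x. c)"
proof (induction k arbitrary: c)
  case (Suc k)
  show ?case by (rule Ck_on_SucI[where f' = "\<lambda>x v. 0"]) (auto simp: Suc)
qed auto

lemma Ck_on_bounded_linear:
  assumes "open S" "bounded_linear f"
  shows "Ck_on k S f"
proof (cases k)
  case 0
  then show ?thesis using assms by (simp add: linear_continuous_on)
next
  case (Suc j)
  show ?thesis unfolding Suc
    by (rule Ck_on_SucI[where f' = "\<lambda>x. f"])
      (auto simp: assms bounded_linear_imp_has_derivative Ck_on_const)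
qed

lemma Ck_on_linear_comp:
  assumes "open S" "bounded_linear g" "Ck_on k S f"
  shows "Ck_on k S (\<lambda>x. g (f x))"
  using assms(3)
proof (induction k arbitrary: f)
  case 0
  then show ?case using assms(2) by (auto intro: bounded_linear.continuous_on)
next
  case (Suc k)
  show ?case
    by (rule Ck_on_SucI[where f' = "\<lambda>x v. g (frechet_derivative f (at x) v)"])
      (use Suc assms in \<open>auto intro: bounded_linear.has_derivative[OF assms(2)]
        simp flip: frechet_derivative_works\<close>)
qed

lemma Ck_on_add:
  assumes "open S" "Ck_on k S f" "Ck_on k S g"
  shows "Ck_on k S (\<lambda>x. f x + g x)"
  using assms(2,3)
proof (induction k arbitrary: f g)
  case 0
  then show ?case by (auto intro: continuous_on_add)
next
  case (Suc k)
  show ?case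
    by (rule Ck_on_SucI[where f' = "\<lambda>x v. frechet_derivative f (at x) v + frechet_derivative g (at x) v"])
      (use Suc assms in \<open>auto intro: has_derivative_add simp flip: frechet_derivative_works\<close>)
qed

lemma Ck_on_mult:
  fixes f g :: "_ \<Rightarrow> real"
  assumes "open S" "Ck_on k S f" "Ck_on k S g"
  shows "Ck_on k S (\<lambda>x. f x * g x)"
  using assms(2,3)
proof (induction k arbitrary: f g)
  case 0
  then show ?case by (auto intro: continuous_on_mult)
next
  case (Suc k)
  \<comment> \<open>The product rule involves the undifferentiated factors as well, and the
    induction hypothesis needs them at order \<open>k\<close>.\<close>
  note low = Ck_on_Suc_imp[OF Suc.prems(1)] Ck_on_Suc_imp[OF Suc.prems(2)]
  show ?case
  proof (rule Ck_on_SucI[where f' = "\<lambda>x v. f x * frechet_derivative g (at x) v + frechet_derivative f (at x) v * g x"])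
    show "((\<lambda>x. f x * g x) has_derivative (\<lambda>v. f x * frechet_derivative g (at x) v + frechet_derivative f (at x) v * g x)) (at x)"
      if "x \<in> S" for x
      by (intro has_derivative_mult Ck_on_Suc_has_derivative[OF _ that]) (use Suc in auto)
    show "Ck_on k S (\<lambda>x. f x * frechet_derivative g (at x) v + frechet_derivative f (at x) v * g x)" for v
      by (rule Ck_on_add[OF assms(1)]; rule Suc.IH) (use Suc.prems low in auto)
  qed (rule assms)
qed

lemma Ck_on_sum:
  assumes "open S" "\<And>i. i \<in> I \<Longrightarrow> Ck_on k S (f i)"
  shows "Ck_on k S (\<lambda>x. \<Sum>i\<in>I. f i x)"
  using assms(2)
proof (induction I rule: infinite_finite_induct)
  case (insert i I)
  then show ?case using Ck_on_add[OF assms(1), of k "f i"] by simp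
qed (auto simp: Ck_on_const[OF assms(1)])

lemma Ck_on_inverse:
  fixes f :: "_ \<Rightarrow> real"
  assumes "open S" "Ck_on k S f" "\<And>x. x \<in> S \<Longrightarrow> f x \<noteq> 0"
  shows "Ck_on k S (\<lambda>x. inverse (f x))"
  using assms(2)
proof (induction k)
  case 0
  then show ?case using assms(3) by (auto intro: continuous_on_inverse)
next
  case (Suc k)
  have low: "Ck_on k S (\<lambda>x. inverse (f x))" using Suc Ck_on_Suc_imp by blast
  show ?case
  \<comment> \<open>The derivative of \<open>1/f\<close> is written in terms of \<open>1/f\<close>
    itself, which is already known to be of class C^k by \<open>low\<close>.\<close>
  proof (rule Ck_on_SucI[where f' = "\<lambda>x v. (-1) * (inverse (f x) * frechet_derivative f (at x) v * inverse (f x))"])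
    show "((\<lambda>x. inverse (f x)) has_derivative (\<lambda>v. (-1) * (inverse (f x) * frechet_derivative f (at x) v * inverse (f x)))) (at x)"
      if "x \<in> S" for x
      using Deriv.has_derivative_inverse[OF assms(3)[OF that] Ck_on_Suc_has_derivative[OF Suc.prems that]] by simp
    show "Ck_on k S (\<lambda>x. (-1) * (inverse (f x) * frechet_derivative f (at x) v * inverse (f x)))" for v
      by (intro Ck_on_mult Ck_on_const assms(1) low) (use Suc.prems in auto)
  qed (rule assms)
qed

lemma Ck_on_compose:
  fixes f :: "'b::euclidean_space \<Rightarrow> real" and g :: "'a::real_normed_vector \<Rightarrow> 'b"
  assumes "open S" "open T" "g ` S \<subseteq> T" "Ck_on k T f" "Ck_on k S g"
  shows "Ck_on k S (\<lambda>x. f (g x))"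
  using assms(4,5)
proof (induction k arbitrary: f)
  case 0
  then show ?case using assms(3) by (auto intro: continuous_on_compose2)
next
  case (Suc k)
  have low: "Ck_on k S g" using Suc.prems Ck_on_Suc_imp by blast
  define f' where "f' y = frechet_derivative f (at y)" for y
  define g' where "g' x = frechet_derivative g (at x)" for x
  have f': "(f has_derivative f' (g x)) (at (g x))" and g': "(g has_derivative g' x) (at x)"
    if "x \<in> S" for x
    unfolding f'_def g'_def using Ck_on_Suc_has_derivative[OF Suc.prems(1)]
      Ck_on_Suc_has_derivative[OF Suc.prems(2) that] assms(3) that by auto
  show ?case
  proof (rule Ck_on_SucI[where f' = "\<lambda>x v. f' (g x) (g' x v)"])
    show "((\<lambda>x. f (g x)) has_derivative (\<lambda>v. f' (g x) (g' x v))) (at x)" if "x \<in> S" for x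
      using has_derivative_compose[OF g' f', OF that that] by simp
    show "Ck_on k S (\<lambda>x. f' (g x) (g' x v))" for v
    \<comment> \<open>Expanding the direction \<open>g' x v\<close> over \<open>Basis\<close> turns
      the chain rule into a sum of products; each factor \<open>f' (g x) i\<close> is a composition
      of lower order.\<close>
    proof (rule Ck_on_cong[OF assms(1)])
      show "Ck_on k S (\<lambda>x. \<Sum>i\<in>Basis. (g' x v \<bullet> i) * f' (g x) i)"
      proof (intro Ck_on_sum Ck_on_mult assms(1))
        fix i :: 'b
        show "Ck_on k S (\<lambda>x. f' (g x) i)"
          by (rule Suc.IH[OF _ low]) (use Suc.prems in \<open>auto simp: f'_def\<close>)
        show "Ck_on k S (\<lambda>x. g' x v \<bullet> i)"
          by (rule Ck_on_linear_comp[OF assms(1) bounded_linear_inner_left])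
            (use Suc.prems in \<open>auto simp: g'_def\<close>)
      qed
      fix x assume "x \<in> S"
      then have lin: "linear (f' (g x))" using f' has_derivative_linear by blast
      have "f' (g x) (\<Sum>i\<in>Basis. (g' x v \<bullet> i) *\<^sub>R i) = (\<Sum>i\<in>Basis. (g' x v \<bullet> i) * f' (g x) i)"
        by (simp add: linear_sum[OF lin] linear_cmul[OF lin])
      then show "(\<Sum>i\<in>Basis. (g' x v \<bullet> i) * f' (g x) i) = f' (g x) (g' x v)"
        by (simp add: euclidean_representation)
    qed
  qed (rule assms)
qed

section \<open>The same closure properties for smooth functions\<close>

lemma smooth_on_mono: "smooth_on S f \<Longrightarrow> W \<subseteq> S \<Longrightarrow> smooth_on W f"
  unfolding smooth_on_def using Ck_on_mono by blast

lemma smooth_on_cong: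
  "open S \<Longrightarrow> (\<And>x. x \<in> S \<Longrightarrow> f x = g x) \<Longrightarrow> smooth_on S f \<Longrightarrow> smooth_on S g"
  unfolding smooth_on_def using Ck_on_cong by blast

lemma smooth_on_local:
  assumes "\<And>x. x \<in> S \<Longrightarrow> \<exists>W. open W \<and> x \<in> W \<and> smooth_on W f"
  shows "smooth_on S f"
  using assms Ck_on_local unfolding smooth_on_def by metis

lemma smooth_on_const: "open S \<Longrightarrow> smooth_on S (\<lambda>x. c)"
  unfolding smooth_on_def using Ck_on_const by blast

lemma smooth_on_bounded_linear: "open S \<Longrightarrow> bounded_linear f \<Longrightarrow> smooth_on S f"
  unfolding smooth_on_def using Ck_on_bounded_linear by blast

lemma smooth_on_add:
  "open S \<Longrightarrow> smooth_on S f \<Longrightarrow> smooth_on S g \<Longrightarrow> smooth_on S (\<lambda>x. f x + g x)"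
  unfolding smooth_on_def using Ck_on_add by blast

lemma smooth_on_mult:
  fixes f g :: "_ \<Rightarrow> real"
  shows "open S \<Longrightarrow> smooth_on S f \<Longrightarrow> smooth_on S g \<Longrightarrow> smooth_on S (\<lambda>x. f x * g x)"
  unfolding smooth_on_def using Ck_on_mult by blast

lemma smooth_on_sum:
  "open S \<Longrightarrow> (\<And>i. i \<in> I \<Longrightarrow> smooth_on S (f i)) \<Longrightarrow> smooth_on S (\<lambda>x. \<Sum>i\<in>I. f i x)"
  unfolding smooth_on_def by (intro allI Ck_on_sum) auto

lemma smooth_on_inverse:
  fixes f :: "_ \<Rightarrow> real"
  shows "open S \<Longrightarrow> smooth_on S f \<Longrightarrow> (\<And>x. x \<in> S \<Longrightarrow> f x \<noteq> 0) \<Longrightarrow> smooth_on S (\<lambda>x. inverse (f x))"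
  unfolding smooth_on_def using Ck_on_inverse by blast

lemma smooth_on_compose:
  fixes f :: "'b::euclidean_space \<Rightarrow> real" and g :: "'a::real_normed_vector \<Rightarrow> 'b"
  shows "open S \<Longrightarrow> open T \<Longrightarrow> g ` S \<subseteq> T \<Longrightarrow> smooth_on T f \<Longrightarrow> smooth_on S g
    \<Longrightarrow> smooth_on S (\<lambda>x. f (g x))"
  unfolding smooth_on_def using Ck_on_compose by blast

lemma smooth_on_has_derivative:
  "smooth_on S f \<Longrightarrow> x \<in> S \<Longrightarrow> (f has_derivative frechet_derivative f (at x)) (at x)"
  unfolding smooth_on_def using Ck_on_Suc_has_derivative by blast

lemma smooth_on_frechet_derivative:
  "smooth_on S f \<Longrightarrow> smooth_on S (\<lambda>x. frechet_derivative f (at x) v)"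
  unfolding smooth_on_def using Ck_on.simps(2) by blast

lemma smooth_on_continuous_on: "smooth_on S f \<Longrightarrow> continuous_on S f"
  unfolding smooth_on_def by (metis Ck_on.simps(1))

section \<open>Flat functions and bump functions on Euclidean space\<close>

text \<open>The powers of \<open>1/t\<close> make the family closed under differentiation up to
  linear combinations, so smoothness of all members follows by one induction on the order. The case
  \<open>k = 0\<close> is the classical flat function.\<close>

definition flat_exp :: "nat \<Rightarrow> real \<Rightarrow> real" where
  "flat_exp k t = (if t > 0 then inverse t ^ k * exp (- inverse t) else 0)"

text \<open>From the right, the substitution of \<open>inverse t\<close> reduces the claim to
  \<open>x ^ k / exp x\<close> tending to 0 at infinity; from the left the function is constantly
  0.\<close>

lemma flat_exp_tendsto_0: "(flat_exp k \<longlongrightarrow> 0) (at 0)"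
proof -
  have "((\<lambda>t. inverse t ^ k * exp (- inverse t)) \<longlongrightarrow> (0::real)) (at_right 0)"
    using filterlim_compose[OF tendsto_power_div_exp_0[of k] filterlim_inverse_at_top_right]
    by (simp add: exp_minus divide_inverse)
  then have "(flat_exp k \<longlongrightarrow> 0) (at_right 0)"
    by (rule Lim_transform_eventually)
      (auto simp: eventually_at_filter flat_exp_def)
  moreover have "(flat_exp k \<longlongrightarrow> 0) (at_left 0)"
    by (rule Lim_transform_eventually[OF tendsto_const])
      (auto simp: eventually_at_filter flat_exp_def)
  ultimately show ?thesis by (simp add: filterlim_split_at)
qed

lemma flat_exp_deriv:
  "(flat_exp k has_real_derivative (flat_exp (k + 2) t - real k * flat_exp (k + 1) t)) (at t)"
proof -
  consider "t > 0" | "t < 0" | "t = 0" by linarith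
  then show ?thesis
  proof cases
    case 1
    have "((\<lambda>t. inverse t ^ k * exp (- inverse t)) has_real_derivative
        (flat_exp (k + 2) t - real k * flat_exp (k + 1) t)) (at t)"
      using 1 by (cases k)
        (auto intro!: derivative_eq_intros simp: flat_exp_def power2_eq_square algebra_simps,
          metis Suc_pred neq0_conv power_Suc)
    then show ?thesis
      by (rule has_field_derivative_transform_within_open[of _ _ _ "{0<..}"])
        (use 1 in \<open>auto simp: flat_exp_def\<close>)
  next
    case 2
    have "((\<lambda>t. 0) has_real_derivative
        (flat_exp (k + 2) t - real k * flat_exp (k + 1) t)) (at t)"
      using 2 by (auto simp: flat_exp_def)
    then show ?thesis
      by (rule has_field_derivative_transform_within_open[of _ _ _ "{..<0}"])
        (use 2 in \<open>auto simp: flat_exp_def\<close>)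
  next
    case 3
    \<comment> \<open>At the origin the difference quotient of \<open>flat_exp k\<close> is
      \<open>flat_exp (Suc k)\<close>, whose limit is already known.\<close>
    have "((\<lambda>h. (flat_exp k (0 + h) - flat_exp k 0) / h) \<longlongrightarrow> 0) (at 0)"
      by (rule Lim_transform_eventually[OF flat_exp_tendsto_0[of "Suc k"]])
        (auto simp: eventually_at_filter flat_exp_def divide_inverse)
    then show ?thesis using 3 by (simp add: DERIV_def flat_exp_def)
  qed
qed

lemma smooth_on_flat_exp: "smooth_on UNIV (flat_exp k)"
proof -
  have "Ck_on m UNIV (flat_exp k)" for m
  proof (induction m arbitrary: k)
    case 0
    show ?case unfolding Ck_on.simps
      by (intro continuous_at_imp_continuous_on ballI DERIV_isCont[OF flat_exp_deriv])
  next
    case (Suc m)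
    show ?case
    proof (rule Ck_on_SucI)
      show "(flat_exp k has_derivative (*) (flat_exp (k + 2) t + (- real k) * flat_exp (k + 1) t)) (at t)" for t
        using flat_exp_deriv[of k t] by (simp add: has_field_derivative_def)
      show "Ck_on m UNIV (\<lambda>t. (flat_exp (k + 2) t + (- real k) * flat_exp (k + 1) t) * v)" for v
        by (intro Ck_on_mult Ck_on_add Ck_on_const Suc.IH open_UNIV)
    qed auto
  qed
  then show ?thesis by (simp add: smooth_on_def)
qed

lemma flat_exp_pos_iff: "flat_exp k t > 0 \<longleftrightarrow> t > 0"
  by (auto simp: flat_exp_def)

lemma flat_exp_nonneg: "flat_exp k t \<ge> 0"
  by (auto simp: flat_exp_def)

lemma flat_exp_eq_0_iff: "flat_exp k t = 0 \<longleftrightarrow> t \<le> 0"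
  by (auto simp: flat_exp_def)

text \<open>The bump is \<open>a / (a + b)\<close>, where \<open>a\<close> is positive exactly
  inside the ball of radius \<open>r\<close> and \<open>b\<close> exactly outside the closed ball of
  radius \<open>r / 2\<close>. These regions cover the space, so the denominator never
  vanishes.\<close>

lemma exists_smooth_bump:
  fixes p :: "'e::euclidean_space"
  assumes "r > 0"
  obtains \<beta> :: "'e \<Rightarrow> real" where "smooth_on UNIV \<beta>" "\<And>y. y \<in> ball p (r / 2) \<Longrightarrow> \<beta> y = 1"
    "\<And>y. y \<notin> ball p r \<Longrightarrow> \<beta> y = 0"
proof
  \<comment> \<open>The squared distance from \<open>p\<close>, written as a polynomial in the
    coordinates so that the sum and product rules give its smoothness.\<close>
  define q where "q y = (\<Sum>i\<in>Basis. ((y - p) \<bullet> i) * ((y - p) \<bullet> i))" for y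
  have q: "q y = (dist p y)\<^sup>2" for y
    by (simp add: q_def dist_norm norm_minus_commute[of p] power2_norm_eq_inner
        flip: euclidean_inner)
  have "smooth_on UNIV (\<lambda>y. (y \<bullet> i) + - (p \<bullet> i))" for i
    by (intro smooth_on_add smooth_on_const smooth_on_bounded_linear bounded_linear_inner_left open_UNIV)
  then have sq: "smooth_on UNIV q"
    unfolding q_def by (intro smooth_on_sum smooth_on_mult open_UNIV) (simp_all add: inner_diff_left)
  define a where "a y = flat_exp 0 (r\<^sup>2 + (-1) * q y)" for y
  define b where "b y = flat_exp 0 (q y + - (r/2)\<^sup>2)" for y
  have sa: "smooth_on UNIV a"
    unfolding a_def
    by (rule smooth_on_compose[OF open_UNIV open_UNIV subset_UNIV smooth_on_flat_exp])
      (intro smooth_on_add smooth_on_mult smooth_on_const sq open_UNIV)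
  have sb: "smooth_on UNIV b"
    unfolding b_def
    by (rule smooth_on_compose[OF open_UNIV open_UNIV subset_UNIV smooth_on_flat_exp])
      (intro smooth_on_add smooth_on_mult smooth_on_const sq open_UNIV)
  have lt: "(r/2)\<^sup>2 < r\<^sup>2" using assms by (simp add: power_strict_mono)
  have pos: "a y + b y > 0" for y
  proof (cases "q y < r\<^sup>2")
    case True
    then have "a y > 0" by (simp add: a_def flat_exp_pos_iff)
    then show ?thesis using flat_exp_nonneg[of 0] b_def by (smt (verit))
  next
    case False
    then have "b y > 0" using lt by (simp add: b_def flat_exp_pos_iff)
    then show ?thesis using flat_exp_nonneg[of 0] a_def by (smt (verit))
  qed
  let ?\<beta> = "\<lambda>y. a y * inverse (a y + b y)"
  show "smooth_on UNIV ?\<beta>"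
    by (intro smooth_on_mult smooth_on_inverse smooth_on_add sa sb open_UNIV) (metis less_irrefl pos)
  show "?\<beta> y = 1" if "y \<in> ball p (r / 2)" for y
  proof -
    have "q y < (r/2)\<^sup>2" using that by (simp add: q power_strict_mono)
    then have "b y = 0" by (simp add: b_def flat_exp_eq_0_iff)
    then show ?thesis using pos[of y] by simp
  qed
  show "?\<beta> y = 0" if "y \<notin> ball p r" for y
  proof -
    have "q y \<ge> r\<^sup>2" using that assms by (simp add: q power_mono)
    then show ?thesis by (simp add: a_def flat_exp_eq_0_iff)
  qed
qed

section \<open>Pointwise evaluation of vector operations on functions\<close>

lemma scaleR_fun_apply [simp]: "(c *\<^sub>R f) x = c *\<^sub>R f x"
  by (simp add: scaleR_fun_def)

lemma sum_fun_apply: "(\<Sum>i\<in>I. f i) x = (\<Sum>i\<in>I. f i x)"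
  by (induction I rule: infinite_finite_induct) auto

subsection \<open>Smooth functions and vector fields on a manifold\<close>

locale smooth_atlas =
  fixes A :: "('m::{t2_space, second_countable_topology}, 'e::euclidean_space) atlas"
  assumes manifold: "smooth_manifold A"
begin

abbreviation "SF \<equiv> smooth_functions A"
abbreviation "VF \<equiv> vector_fields A"
abbreviation "TS \<equiv> tangent_space A"

lemma chart_exists: obtains U \<phi> where "(U, \<phi>) \<in> A" "z \<in> U"
proof -
  have "z \<in> (\<Union>(U, \<phi>)\<in>A. U)" using manifold by (simp add: smooth_manifold_def)
  then show ?thesis using that by auto
qed

context
  fixes U \<phi> assumes chart: "(U, \<phi>) \<in> A"
begin

lemma chart_homeomorphism: "homeomorphism U (\<phi> ` U) \<phi> (inv_into U \<phi>)"
  and chart_open: "open U" and chart_open_image: "open (\<phi> ` U)"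
  using manifold chart by (auto simp: smooth_manifold_def)

lemma chart_inv: "w \<in> U \<Longrightarrow> inv_into U \<phi> (\<phi> w) = w"
  using chart_homeomorphism by (simp add: homeomorphism_def)

lemma chart_continuous: "continuous_on U \<phi>"
  using chart_homeomorphism by (simp add: homeomorphism_def)

lemma chart_inv_continuous: "continuous_on (\<phi> ` U) (inv_into U \<phi>)"
  using chart_homeomorphism by (simp add: homeomorphism_def)

lemma chart_open_image_Int:
  assumes "open W" shows "open (\<phi> ` (U \<inter> W))"
proof -
  have "\<phi> ` (U \<inter> W) = \<phi> ` U \<inter> inv_into U \<phi> -` W" using chart_inv by auto
  then show ?thesis
    using continuous_open_preimage[OF chart_inv_continuous chart_open_image assms] by simp
qed

lemma smooth_functions_chart:
  "f \<in> SF \<Longrightarrow> smooth_on (\<phi> ` U) (\<lambda>y. f (inv_into U \<phi> y))"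
  using chart by (auto simp: smooth_functions_def comp_def)

lemma transition_smooth:
  "(V, \<psi>) \<in> A \<Longrightarrow> smooth_on (\<phi> ` (U \<inter> V)) (\<lambda>y. \<psi> (inv_into U \<phi> y))"
  using manifold chart by (fastforce simp: smooth_manifold_def comp_def)

end

lemma smooth_functionsI:
  "(\<And>U \<phi>. (U, \<phi>) \<in> A \<Longrightarrow> smooth_on (\<phi> ` U) (\<lambda>y. f (inv_into U \<phi> y))) \<Longrightarrow> f \<in> SF"
  by (auto simp: smooth_functions_def comp_def)

section \<open>The ring of smooth functions and its germs\<close>

lemma SF_const: "(\<lambda>z. c) \<in> SF"
  by (rule smooth_functionsI, rule smooth_on_const, rule chart_open_image)

lemma SF_add: "f \<in> SF \<Longrightarrow> g \<in> SF \<Longrightarrow> (\<lambda>z. f z + g z) \<in> SF"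
  by (rule smooth_functionsI, rule smooth_on_add) (simp_all add: chart_open_image smooth_functions_chart)

lemma SF_mult: "f \<in> SF \<Longrightarrow> g \<in> SF \<Longrightarrow> (\<lambda>z. f z * g z) \<in> SF"
  by (rule smooth_functionsI, rule smooth_on_mult) (simp_all add: chart_open_image smooth_functions_chart)

lemma SF_compose:
  assumes "smooth_on UNIV r" "f \<in> SF" shows "(\<lambda>z. r (f z)) \<in> SF"
  by (rule smooth_functionsI, rule smooth_on_compose[OF _ open_UNIV subset_UNIV assms(1)])
    (simp_all add: chart_open_image smooth_functions_chart assms(2))

lemma SF_inverse:
  assumes "f \<in> SF" "\<And>z. f z \<noteq> (0::real)" shows "(\<lambda>z. inverse (f z)) \<in> SF"
  by (rule smooth_functionsI, rule smooth_on_inverse)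
    (simp_all add: chart_open_image smooth_functions_chart assms)

lemma SF_local:
  assumes "\<And>z. \<exists>g\<in>SF. \<forall>\<^sub>F w in nhds z. f w = g w"
  shows "f \<in> SF"
proof (rule smooth_functionsI)
  fix U \<phi> assume c: "(U, \<phi>) \<in> A"
  show "smooth_on (\<phi> ` U) (\<lambda>y. f (inv_into U \<phi> y))"
  proof (rule smooth_on_local)
    fix y assume "y \<in> \<phi> ` U"
    then obtain z where z: "z \<in> U" "y = \<phi> z" by auto
    obtain g W where g: "g \<in> SF" "open W" "z \<in> W" "\<And>w. w \<in> W \<Longrightarrow> f w = g w"
      using assms[of z] unfolding eventually_nhds by auto
    have op: "open (\<phi> ` (U \<inter> W))" using chart_open_image_Int[OF c] g by blast
    have "smooth_on (\<phi> ` (U \<inter> W)) (\<lambda>y. g (inv_into U \<phi> y))"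
      by (rule smooth_on_mono[OF smooth_functions_chart[OF c g(1)]]) auto
    then have "smooth_on (\<phi> ` (U \<inter> W)) (\<lambda>y. f (inv_into U \<phi> y))"
      by (rule smooth_on_cong[OF op, rotated]) (auto simp: g chart_inv[OF c])
    then show "\<exists>W. open W \<and> y \<in> W \<and> smooth_on W (\<lambda>y. f (inv_into U \<phi> y))"
      using op z g by blast
  qed
qed

lemma SF_isCont:
  assumes "f \<in> SF" shows "isCont f z"
proof -
  obtain U \<phi> where c: "(U, \<phi>) \<in> A" "z \<in> U" using chart_exists by blast
  have "continuous_on U (\<lambda>w. f (inv_into U \<phi> (\<phi> w)))"
    by (rule continuous_on_compose2[OF smooth_on_continuous_on[OF smooth_functions_chart[OF c(1) assms]]
          chart_continuous[OF c(1)]]) auto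
  then have "continuous_on U f" by (simp add: chart_inv[OF c(1)] cong: continuous_on_cong)
  then show ?thesis using chart_open[OF c(1)] c(2) continuous_on_eq_continuous_at by blast
qed

text \<open>Germs that do not vanish at \<open>z\<close> are units. To get a globally smooth inverse
  despite zeros of \<open>f\<close> elsewhere, \<open>f\<close> is divided by a positive function
  \<open>d\<close> that equals \<open>f * f\<close> wherever the square of \<open>f\<close> exceeds
  half its value at \<open>z\<close>.\<close>

lemma SF_local_inverse:
  assumes "f \<in> SF" "f z \<noteq> 0"
  obtains g where "g \<in> SF" "\<forall>\<^sub>F w in nhds z. g w * f w = 1"
proof
  define d where "d w = f w * f w + flat_exp 0 ((f z)\<^sup>2 / 2 + (-1) * (f w * f w))" for w
  have "d w > 0" for w
  proof (cases "f w = 0")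
    case True
    then show ?thesis using assms(2) by (simp add: d_def flat_exp_pos_iff)
  next
    case False
    then have "0 < f w * f w" using zero_less_power2[of "f w"] by (simp add: power2_eq_square)
    then show ?thesis using flat_exp_nonneg[of 0] by (simp add: d_def add_pos_nonneg)
  qed
  then have nz: "d w \<noteq> 0" for w by (metis less_irrefl)
  have "d \<in> SF"
    unfolding d_def
    by (intro SF_add SF_mult SF_const SF_compose[OF smooth_on_flat_exp] assms(1))
  then show "(\<lambda>w. f w * inverse (d w)) \<in> SF"
    by (intro SF_mult SF_inverse nz assms(1))
  have "isCont (\<lambda>w. (f w)\<^sup>2) z"
    by (intro continuous_intros SF_isCont assms(1))
  moreover have "(f z)\<^sup>2 / 2 < (f z)\<^sup>2" using assms(2) by simp
  ultimately have "\<forall>\<^sub>F w in nhds z. (f z)\<^sup>2 / 2 < (f w)\<^sup>2"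
    unfolding continuous_at using order_tendstoD(1) tendsto_at_iff_tendsto_nhds by blast
  then show "\<forall>\<^sub>F w in nhds z. f w * inverse (d w) * f w = 1"
  proof eventually_elim
    case (elim w)
    then have "d w = f w * f w" by (simp add: d_def flat_exp_eq_0_iff power2_eq_square)
    then show ?case using nz[of w] by (simp add: field_simps)
  qed
qed

section \<open>Extension by zero from a chart, and bump functions on the manifold\<close>

definition chart_extend :: "'m set \<Rightarrow> ('m \<Rightarrow> 'e) \<Rightarrow> ('e \<Rightarrow> real) \<Rightarrow> 'm \<Rightarrow> real" where
  "chart_extend U \<phi> g w = (if w \<in> U then g (\<phi> w) else 0)"

text \<open>The manifold being Hausdorff, the preimage of the compact set \<open>K\<close> is
  closed. So the chart domain, where a transition map applies, and the complement of that preimage,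
  where the function is 0, form an open cover.\<close>

lemma chart_extend_SF:
  assumes c: "(U, \<phi>) \<in> A" and g: "smooth_on (\<phi> ` U) g"
    and K: "compact K" "K \<subseteq> \<phi> ` U" "\<And>y. y \<notin> K \<Longrightarrow> g y = 0"
  shows "chart_extend U \<phi> g \<in> SF"
proof (rule smooth_functionsI)
  fix V \<psi> assume c': "(V, \<psi>) \<in> A"
  let ?K = "inv_into U \<phi> ` K"
  have "compact ?K"
    by (rule compact_continuous_image[OF continuous_on_subset[OF chart_inv_continuous[OF c] K(2)] K(1)])
  then have op: "open (- ?K)" using compact_imp_closed by blast
  have zero: "chart_extend U \<phi> g w = 0" if "w \<notin> ?K" for w
    using that K(3) chart_inv[OF c] unfolding chart_extend_def by (metis imageI)
  show "smooth_on (\<psi> ` V) (\<lambda>y. chart_extend U \<phi> g (inv_into V \<psi> y))"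
  proof (rule smooth_on_local)
    fix y assume "y \<in> \<psi> ` V"
    then obtain z where z: "z \<in> V" "y = \<psi> z" by auto
    show "\<exists>W. open W \<and> y \<in> W \<and> smooth_on W (\<lambda>y. chart_extend U \<phi> g (inv_into V \<psi> y))"
    proof (cases "z \<in> U")
      case True
      let ?W = "\<psi> ` (V \<inter> U)"
      have W: "open ?W" using chart_open_image_Int[OF c' chart_open[OF c]] .
      have "smooth_on ?W (\<lambda>y. g (\<phi> (inv_into V \<psi> y)))"
        by (rule smooth_on_compose[OF W chart_open_image[OF c] _ g transition_smooth[OF c' c]])
          (auto simp: chart_inv[OF c'])
      then have "smooth_on ?W (\<lambda>y. chart_extend U \<phi> g (inv_into V \<psi> y))"
        by (rule smooth_on_cong[OF W, rotated]) (auto simp: chart_inv[OF c'] chart_extend_def)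
      then show ?thesis using W True z by blast
    next
      case False
      let ?W = "\<psi> ` (V \<inter> - ?K)"
      have W: "open ?W" using chart_open_image_Int[OF c' op] .
      have "smooth_on ?W (\<lambda>y. chart_extend U \<phi> g (inv_into V \<psi> y))"
        by (rule smooth_on_cong[OF W _ smooth_on_const[OF W, of 0]])
          (auto simp: chart_inv[OF c'] zero)
      moreover have "?K \<subseteq> U" using K(2) by (auto intro: inv_into_into)
      then have "z \<notin> ?K" using False by blast
      ultimately show ?thesis using W z by blast
    qed
  qed
qed

lemma SF_bump:
  assumes "open W" "z \<in> W"
  obtains \<rho> where "\<rho> \<in> SF" "\<forall>\<^sub>F w in nhds z. \<rho> w = 1" "\<And>w. w \<notin> W \<Longrightarrow> \<rho> w = 0"
proof -
  obtain U \<phi> where c: "(U, \<phi>) \<in> A" "z \<in> U" using chart_exists by blast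
  have op: "open (\<phi> ` (U \<inter> W))" using chart_open_image_Int[OF c(1) assms(1)] .
  then obtain r where r: "r > 0" "cball (\<phi> z) r \<subseteq> \<phi> ` (U \<inter> W)"
    using open_contains_cball assms(2) c(2) by blast
  obtain \<beta> :: "'e \<Rightarrow> real" where \<beta>: "smooth_on UNIV \<beta>"
      "\<And>y. y \<in> ball (\<phi> z) (r / 2) \<Longrightarrow> \<beta> y = 1" "\<And>y. y \<notin> ball (\<phi> z) r \<Longrightarrow> \<beta> y = 0"
    using exists_smooth_bump[OF r(1)] by metis
  show thesis
  proof
    show "chart_extend U \<phi> \<beta> \<in> SF"
      by (rule chart_extend_SF[OF c(1), of _ "cball (\<phi> z) r"])
        (use r \<beta> in \<open>auto intro: smooth_on_mono[OF _ subset_UNIV]\<close>)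
    have "open (U \<inter> \<phi> -` ball (\<phi> z) (r / 2))"
      using continuous_open_preimage[OF chart_continuous chart_open] c(1) by blast
    then show "\<forall>\<^sub>F w in nhds z. chart_extend U \<phi> \<beta> w = 1"
      unfolding eventually_nhds
      by (intro exI[of _ "U \<inter> \<phi> -` ball (\<phi> z) (r / 2)"])
        (use c(2) r(1) \<beta> in \<open>auto simp: chart_extend_def\<close>)
    show "chart_extend U \<phi> \<beta> w = 0" if "w \<notin> W" for w
    proof (cases "w \<in> U")
      case True
      then have "\<phi> w \<notin> \<phi> ` (U \<inter> W)" using that chart_inv[OF c(1)] by (metis Int_iff imageE)
      then have "\<phi> w \<notin> ball (\<phi> z) r" using r(2) ball_subset_cball by blast
      then show ?thesis using \<beta>(3) by (simp add: chart_extend_def)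
    qed (simp add: chart_extend_def)
  qed
qed

section \<open>Tangent spaces and the module of vector fields\<close>

lemma TS_add: "u \<in> TS z \<Longrightarrow> w \<in> TS z \<Longrightarrow> u + w \<in> TS z"
  by (auto simp: tangent_space_def algebra_simps)

lemma TS_scale: "u \<in> TS z \<Longrightarrow> c *\<^sub>R u \<in> TS z"
  by (auto simp: tangent_space_def algebra_simps)

lemma TS_0: "0 \<in> TS z"
  by (auto simp: tangent_space_def)

lemma subspace_TS: "subspace (TS z)"
  by (simp add: subspace_def TS_add TS_scale TS_0)

lemma VF_D:
  assumes "X \<in> VF"
  shows "X z \<in> TS z" and "f \<in> SF \<Longrightarrow> (\<lambda>z. X z f) \<in> SF"
  using assms by (auto simp: vector_fields_def)

lemma VF_I:
  "(\<And>z. X z \<in> TS z) \<Longrightarrow> (\<And>f. f \<in> SF \<Longrightarrow> (\<lambda>z. X z f) \<in> SF) \<Longrightarrow> X \<in> VF"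
  by (auto simp: vector_fields_def)

lemma VF_0: "0 \<in> VF"
  by (rule VF_I) (auto simp: TS_0 SF_const)

lemma VF_add: "X \<in> VF \<Longrightarrow> Y \<in> VF \<Longrightarrow> X + Y \<in> VF"
  by (rule VF_I) (auto simp: VF_D TS_add SF_add)

lemma VF_mult: "f \<in> SF \<Longrightarrow> X \<in> VF \<Longrightarrow> fun_mult f X \<in> VF"
  by (rule VF_I) (auto simp: VF_D TS_scale SF_mult fun_mult_def)

lemma VF_scale: "X \<in> VF \<Longrightarrow> c *\<^sub>R X \<in> VF"
  by (rule VF_I) (auto simp: VF_D TS_scale SF_mult SF_const)

lemma VF_uminus: "X \<in> VF \<Longrightarrow> - X \<in> VF"
  using VF_scale[of X "-1"] by simp

lemma VF_diff: "X \<in> VF \<Longrightarrow> Y \<in> VF \<Longrightarrow> X - Y \<in> VF"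
  using VF_add[OF _ VF_uminus] by fastforce

lemma VF_sum: "(\<And>i. i \<in> I \<Longrightarrow> X i \<in> VF) \<Longrightarrow> (\<Sum>i\<in>I. X i) \<in> VF"
  by (induction I rule: infinite_finite_induct) (auto simp: VF_0 VF_add)

lemma VF_local:
  assumes "\<And>z. \<exists>Y\<in>VF. \<forall>\<^sub>F w in nhds z. X w = Y w"
  shows "X \<in> VF"
proof (rule VF_I)
  show "X z \<in> TS z" for z using assms[of z] by (auto dest!: eventually_nhds_x_imp_x simp: VF_D)
  fix f assume f: "f \<in> SF"
  show "(\<lambda>z. X z f) \<in> SF"
  proof (rule SF_local)
    fix z
    obtain Y where Y: "Y \<in> VF" "\<forall>\<^sub>F w in nhds z. X w = Y w" using assms by blast
    then show "\<exists>g\<in>SF. \<forall>\<^sub>F w in nhds z. X w f = g w"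
      by (intro bexI[of _ "\<lambda>w. Y w f"]) (auto simp: VF_D f elim: eventually_mono)
  qed
qed

section \<open>Coordinate fields and coordinate functions\<close>

text \<open>Coordinates and partial derivatives become global after multiplication by a bump
  function that is 1 near \<open>z\<close>, where their duality is therefore unchanged. Duality
  yields independence; that the fields also span is obtained in \<open>coordinate_basis\<close> by
  counting dimensions.\<close>

lemma coordinate_frame:
  obtains E :: "'e \<Rightarrow> 'm field" and x :: "'e \<Rightarrow> 'm \<Rightarrow> real"
  where "\<And>i. E i \<in> VF" "\<And>i. x i \<in> SF"
    "\<forall>\<^sub>F w in nhds z. \<forall>i\<in>Basis. \<forall>j\<in>Basis. E i w (x j) = (if i = j then 1 else 0)"
proof -
  obtain U \<phi> where c: "(U, \<phi>) \<in> A" "z \<in> U" using chart_exists by blast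
  define S where "S = \<phi> ` U"
  have S: "open S" unfolding S_def using chart_open_image[OF c(1)] .
  then obtain r where r: "r > 0" "cball (\<phi> z) r \<subseteq> S"
    using open_contains_cball c(2) S_def by blast
  obtain \<beta> :: "'e \<Rightarrow> real" where \<beta>: "smooth_on UNIV \<beta>"
      "\<And>y. y \<in> ball (\<phi> z) (r / 2) \<Longrightarrow> \<beta> y = 1" "\<And>y. y \<notin> ball (\<phi> z) r \<Longrightarrow> \<beta> y = 0"
    using exists_smooth_bump[OF r(1)] by metis
  have ext: "chart_extend U \<phi> (\<lambda>y. \<beta> y * g y) \<in> SF" if "smooth_on S g" for g
  proof (rule chart_extend_SF[OF c(1), of _ "cball (\<phi> z) r"])
    show "smooth_on (\<phi> ` U) (\<lambda>y. \<beta> y * g y)"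
      using smooth_on_mult[OF S smooth_on_mono[OF \<beta>(1)] that] by (simp add: S_def)
  qed (use r \<beta>(3) S_def in auto)
  define loc where "loc f y = f (inv_into U \<phi> y)" for f :: "'m \<Rightarrow> real" and y
  have loc_smooth: "smooth_on S (loc f)" if "f \<in> SF" for f
    using smooth_functions_chart[OF c(1) that] by (simp add: S_def loc_def[abs_def])
  have loc_deriv: "(loc f has_derivative frechet_derivative (loc f) (at (\<phi> w))) (at (\<phi> w))"
    if "f \<in> SF" "w \<in> U" for f w
    using smooth_on_has_derivative[OF loc_smooth] that S_def by auto
  define d where "d i f y = frechet_derivative (loc f) (at y) i" for i f y
  have d_eqI: "d i f (\<phi> w) = f' i" if "(loc f has_derivative f') (at (\<phi> w))" for i f f' w
    using frechet_derivative_at[OF that] by (simp add: d_def)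
  \<comment> \<open>The value 0 off the smooth functions follows the convention in
    \<open>tangent_space\<close>.\<close>
  define E where "E i w f = (if f \<in> SF then chart_extend U \<phi> (\<lambda>y. \<beta> y * d i f y) w else 0)" for i w f
  define x where "x j = chart_extend U \<phi> (\<lambda>y. \<beta> y * (y \<bullet> j))" for j
  have x_SF: "x j \<in> SF" for j
    unfolding x_def by (intro ext smooth_on_bounded_linear S bounded_linear_inner_left)
  show thesis
  proof
    show "x j \<in> SF" for j by (rule x_SF)
    show "E i \<in> VF" for i
    proof (rule VF_I)
      fix w
      have "E i w (\<lambda>z. f z + g z) = E i w f + E i w g
         \<and> E i w (\<lambda>z. f z * g z) = f w * E i w g + g w * E i w f"
        if fg: "f \<in> SF" "g \<in> SF" for f g
      proof (cases "w \<in> U")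
        case True
        have "d i (\<lambda>z. f z + g z) (\<phi> w) = d i f (\<phi> w) + d i g (\<phi> w)"
          unfolding d_def[of i f] d_def[of i g]
          by (rule d_eqI) (use has_derivative_add[OF loc_deriv loc_deriv] fg True in \<open>simp add: loc_def[abs_def]\<close>)
        moreover have "d i (\<lambda>z. f z * g z) (\<phi> w) = loc f (\<phi> w) * d i g (\<phi> w) + d i f (\<phi> w) * loc g (\<phi> w)"
          unfolding d_def[of i f] d_def[of i g]
          by (rule d_eqI) (use has_derivative_mult[OF loc_deriv loc_deriv] fg True in \<open>simp add: loc_def[abs_def]\<close>)
        ultimately show ?thesis
          using fg True
          by (simp add: E_def chart_extend_def SF_add SF_mult loc_def chart_inv[OF c(1)] algebra_simps)
      qed (use fg in \<open>simp add: E_def chart_extend_def\<close>)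
      moreover have "E i w (\<lambda>z. a * f z) = a * E i w f" if f: "f \<in> SF" for f a
      proof (cases "w \<in> U")
        case True
        have "d i (\<lambda>z. a * f z) (\<phi> w) = a * d i f (\<phi> w)"
          unfolding d_def[of i f]
          by (rule d_eqI) (use has_derivative_mult_right[OF loc_deriv, of f w a] f True in \<open>simp add: loc_def[abs_def]\<close>)
        then show ?thesis
          using f True by (simp add: E_def chart_extend_def SF_mult SF_const)
      qed (use f in \<open>simp add: E_def chart_extend_def\<close>)
      ultimately show "E i w \<in> TS w"
        unfolding tangent_space_def by (auto simp: E_def)
      fix f assume f: "f \<in> SF"
      show "(\<lambda>w. E i w f) \<in> SF"
        using ext[OF smooth_on_frechet_derivative[OF loc_smooth[OF f]], of i] f
        by (simp add: E_def d_def)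
    qed
    have "open (U \<inter> \<phi> -` ball (\<phi> z) (r / 2))"
      using continuous_open_preimage[OF chart_continuous chart_open] c(1) by blast
    moreover have "E i w (x j) = (if i = j then 1 else 0)"
      if w: "w \<in> U \<inter> \<phi> -` ball (\<phi> z) (r / 2)" and ij: "i \<in> Basis" "j \<in> Basis" for w i j
    proof -
      have "(loc (x j) has_derivative (\<lambda>v. v \<bullet> j)) (at (\<phi> w))"
      proof (rule has_derivative_transform_within_open[of "\<lambda>y. y \<bullet> j"])
        show "((\<lambda>y. y \<bullet> j) has_derivative (\<lambda>v. v \<bullet> j)) (at (\<phi> w))"
          by (intro bounded_linear_imp_has_derivative bounded_linear_inner_left)
        show "open (S \<inter> ball (\<phi> z) (r / 2))" using S by auto
        show "\<phi> w \<in> S \<inter> ball (\<phi> z) (r / 2)" using w S_def by auto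
        show "y \<bullet> j = loc (x j) y" if "y \<in> S \<inter> ball (\<phi> z) (r / 2)" for y
          using that \<beta>(2)
          by (auto simp: loc_def x_def chart_extend_def S_def chart_inv[OF c(1)])
      qed
      then have "d i (x j) (\<phi> w) = i \<bullet> j" by (rule d_eqI)
      then show ?thesis using w \<beta>(2) ij by (simp add: E_def x_SF chart_extend_def inner_Basis)
    qed
    ultimately show "\<forall>\<^sub>F w in nhds z. \<forall>i\<in>Basis. \<forall>j\<in>Basis. E i w (x j) = (if i = j then 1 else 0)"
      unfolding eventually_nhds
      by (intro exI[of _ "U \<inter> \<phi> -` ball (\<phi> z) (r / 2)"]) (use c(2) r(1) in auto)
  qed
qed

end

subsection \<open>Vector 1-forms and germs of vector fields\<close>

text \<open>As simp rules these eta-expand unapplied sums and multiples of tangent vectors.\<close>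

declare plus_fun_apply [simp del] zero_fun_apply [simp del] scaleR_fun_apply [simp del]
  minus_apply [simp del] uminus_apply [simp del]

lemmas fun_ops_apply = plus_fun_apply zero_fun_apply scaleR_fun_apply minus_apply uminus_apply

section \<open>Linear algebra of finite indexed families\<close>

lemma span_family_sum:
  fixes F :: "'i \<Rightarrow> 'a::real_vector"
  assumes "finite I" "u \<in> span (F ` I)"
  obtains c where "u = (\<Sum>i\<in>I. c i *\<^sub>R F i)"
proof -
  have "\<exists>c. u = (\<Sum>i\<in>I. c i *\<^sub>R F i)"
    using assms
  proof (induction I arbitrary: u)
    case (insert j I)
    then obtain k c where "u - k *\<^sub>R F j = (\<Sum>i\<in>I. c i *\<^sub>R F i)"
      by (metis image_insert span_breakdown_eq)
    then have "u = (\<Sum>i\<in>insert j I. (c(j := k)) i *\<^sub>R F i)"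
      using insert.hyps by (simp add: algebra_simps cong: sum.cong)
        (smt (verit, best) sum.cong)
    then show ?case by blast
  qed simp
  then show ?thesis using that by blast
qed

text \<open>A vector of \<open>W\<close> outside the span could be adjoined to the family, giving
  more independent vectors in \<open>span W\<close> than \<open>W\<close> has elements.\<close>

lemma independent_family_spans:
  fixes F :: "'i \<Rightarrow> 'a::real_vector"
  assumes I: "finite I" and ind: "\<And>c. (\<Sum>i\<in>I. c i *\<^sub>R F i) = 0 \<Longrightarrow> \<forall>i\<in>I. c i = 0"
    and W: "finite W" "F ` I \<subseteq> span W" "card W \<le> card I"
  shows "W \<subseteq> span (F ` I)"
proof (rule ccontr)
  assume "\<not> W \<subseteq> span (F ` I)"
  then obtain w where w: "w \<in> W" "w \<notin> span (F ` I)" by blast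
  have inj: "inj_on F I"
  proof (rule inj_onI, rule ccontr)
    fix i j assume ij: "i \<in> I" "j \<in> I" "F i = F j" "i \<noteq> j"
    \<comment> \<open>These coefficients express \<open>F i - F j\<close>, a nontrivial relation if
      two distinct indices gave the same vector.\<close>
    let ?c = "\<lambda>k. (if k = i then 1 else 0) - (if k = j then 1 else (0::real))"
    have "(\<Sum>k\<in>I. ?c k *\<^sub>R F k) = F i - F j"
      using ij I by (simp add: scaleR_diff_left sum_subtractf if_distrib[of "\<lambda>a. a *\<^sub>R _"] cong: if_cong)
    then show False using ind[of ?c] ij by auto
  qed
  have "independent (F ` I)"
  proof (rule independent_if_scalars_zero)
    fix f v assume "(\<Sum>x\<in>F ` I. f x *\<^sub>R x) = 0" "v \<in> F ` I"
    then show "f v = 0" using ind[of "f \<circ> F"] by (auto simp: sum.reindex[OF inj])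
  qed (use I in simp)
  then have "independent (insert w (F ` I))" using w by (simp add: independent_insert)
  moreover have "insert w (F ` I) \<subseteq> span W" using w(1) W(2) by (simp add: span_base)
  ultimately have "card (insert w (F ` I)) \<le> card W" using independent_span_bound[OF W(1)] by blast
  moreover have "w \<notin> F ` I" using w(2) span_base[of w "F ` I"] by linarith
  ultimately show False using W(3) I by (simp add: card_image[OF inj])
qed

text \<open>A nonzero coefficient would allow its vector to be dropped from the family, leaving too
  few vectors to span a set of dimension \<open>card I\<close>.\<close>

lemma spanning_family_independent:
  fixes F :: "'i \<Rightarrow> 'a::real_vector"
  assumes I: "finite I" and V: "V \<subseteq> span (F ` I)" "dim V = card I"
    and c: "(\<Sum>i\<in>I. c i *\<^sub>R F i) = 0"
  shows "\<forall>i\<in>I. c i = 0"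
proof (rule ccontr)
  assume "\<not> (\<forall>i\<in>I. c i = 0)"
  then obtain j where j: "j \<in> I" "c j \<noteq> 0" by blast
  let ?S = "F ` (I - {j})"
  have "c j *\<^sub>R F j = - (\<Sum>i\<in>I - {j}. c i *\<^sub>R F i)"
    using c I j by (simp add: sum.remove eq_neg_iff_add_eq_0)
  moreover have "(\<Sum>i\<in>I - {j}. c i *\<^sub>R F i) \<in> span ?S"
    by (intro span_sum span_scale span_base) auto
  ultimately have "c j *\<^sub>R F j \<in> span ?S" by (simp add: span_neg)
  then have "inverse (c j) *\<^sub>R c j *\<^sub>R F j \<in> span ?S" by (rule span_scale)
  then have "F j \<in> span ?S" using j by simp
  then have "F ` I \<subseteq> span ?S" by (auto intro: span_base)
  then have sub: "V \<subseteq> span ?S" using V(1) span_minimal[OF _ subspace_span] by blast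
  obtain B where B: "B \<subseteq> V" "independent B" "card B = dim V" using basis_exists by metis
  have "card B \<le> card ?S"
    using independent_span_bound[OF _ B(2), of ?S] sub B(1) I by auto
  also have "\<dots> \<le> card (I - {j})" using I by (intro card_image_le) simp
  finally show False using B(3) V(2) I j by (metis card_Diff1_less not_le)
qed

context smooth_atlas
begin

section \<open>Algebra of vector 1-forms\<close>

context
  fixes K assumes K: "vector_one_form A K"
begin

lemma form_TS: "u \<in> TS z \<Longrightarrow> K z u \<in> TS z"
  and form_add: "u \<in> TS z \<Longrightarrow> w \<in> TS z \<Longrightarrow> K z (u + w) = K z u + K z w"
  and form_scale: "u \<in> TS z \<Longrightarrow> K z (c *\<^sub>R u) = c *\<^sub>R K z u"
  and form_outside: "u \<notin> TS z \<Longrightarrow> K z u = 0"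
  and form_VF: "X \<in> VF \<Longrightarrow> K \<cdot> X \<in> VF"
  using K by (auto simp: vector_one_form_def)

lemma form_0: "K z 0 = 0"
  using form_scale[OF TS_0, of z 0] by simp

lemma form_neg: "u \<in> TS z \<Longrightarrow> K z (- u) = - K z u"
  using form_scale[of u z "-1"] by simp

lemma form_diff: "u \<in> TS z \<Longrightarrow> w \<in> TS z \<Longrightarrow> K z (u - w) = K z u - K z w"
  using form_add[of u z "- w"] form_neg[of w] TS_scale[of w z "-1"] by simp

lemma form_sum:
  "(\<And>i. i \<in> I \<Longrightarrow> u i \<in> TS z) \<Longrightarrow> K z (\<Sum>i\<in>I. c i *\<^sub>R u i) = (\<Sum>i\<in>I. c i *\<^sub>R K z (u i))"
proof (induction I rule: infinite_finite_induct)
  case (insert i I)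
  then have "(\<Sum>i\<in>I. c i *\<^sub>R u i) \<in> TS z" by (intro subspace_sum subspace_scale subspace_TS) auto
  then show ?case using insert by (simp add: form_add form_scale TS_scale)
qed (auto simp: form_0)

end

text \<open>This provides both \<open>G = L - J\<close> and \<open>H = L + J\<close>.\<close>

lemma form_combine:
  assumes P: "vector_one_form A P" and Q: "vector_one_form A Q"
  shows "vector_one_form A (\<lambda>z u. P z u + c *\<^sub>R Q z u)"
  unfolding vector_one_form_def
proof (intro conjI allI ballI impI)
  fix z u assume u: "u \<in> TS z"
  show "P z u + c *\<^sub>R Q z u \<in> TS z" using u by (simp add: TS_add TS_scale form_TS[OF P] form_TS[OF Q])
  show "P z (a *\<^sub>R u) + c *\<^sub>R Q z (a *\<^sub>R u) = a *\<^sub>R (P z u + c *\<^sub>R Q z u)" for a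
    using u by (simp add: form_scale[OF P] form_scale[OF Q] scaleR_add_right)
  fix w assume "w \<in> TS z"
  then show "P z (u + w) + c *\<^sub>R Q z (u + w) = P z u + c *\<^sub>R Q z u + (P z w + c *\<^sub>R Q z w)"
    using u by (simp add: form_add[OF P] form_add[OF Q] scaleR_add_right)
next
  show "P z u + c *\<^sub>R Q z u = 0" if "u \<notin> TS z" for z u
    using that by (simp add: form_outside[OF P] form_outside[OF Q])
  fix X assume X: "X \<in> VF"
  have "(\<lambda>z u. P z u + c *\<^sub>R Q z u) \<cdot> X = P \<cdot> X + c *\<^sub>R (Q \<cdot> X)"
    by (rule ext) (simp add: form_app_def plus_fun_apply[of "\<lambda>z. P z (X z)"] scaleR_fun_apply[of c "\<lambda>z. Q z (X z)"])
  then show "(\<lambda>z u. P z u + c *\<^sub>R Q z u) \<cdot> X \<in> VF"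
    using VF_add[OF form_VF[OF P X] VF_scale[OF form_VF[OF Q X]]] by simp
qed

lemma form_comp_form:
  assumes P: "vector_one_form A P" and Q: "vector_one_form A Q"
  shows "vector_one_form A (P \<odot> Q)"
  unfolding vector_one_form_def
  using form_TS[OF P] form_TS[OF Q] form_add[OF P] form_add[OF Q] form_scale[OF P] form_scale[OF Q]
    form_0[OF P] form_outside[OF Q] form_VF[OF P form_VF[OF Q]]
  by (auto simp: form_comp_def form_app_def)

section \<open>Germs of vector fields and Steinitz exchange\<close>

text \<open>The submodule generated by the germs at \<open>z\<close> of the fields in \<open>S\<close>, over the ring of germs of
  smooth functions.\<close>

inductive_set germ_span :: "'m \<Rightarrow> 'm field set \<Rightarrow> 'm field set" for z S where
  germ_base: "E \<in> S \<Longrightarrow> E \<in> germ_span z S"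
| germ_0: "0 \<in> germ_span z S"
| germ_add: "X \<in> germ_span z S \<Longrightarrow> Y \<in> germ_span z S \<Longrightarrow> X + Y \<in> germ_span z S"
| germ_mult: "a \<in> SF \<Longrightarrow> X \<in> germ_span z S \<Longrightarrow> fun_mult a X \<in> germ_span z S"
| germ_cong: "X \<in> germ_span z S \<Longrightarrow> \<forall>\<^sub>F w in nhds z. Y w = X w \<Longrightarrow> Y \<in> germ_span z S"

lemma germ_sum: "(\<And>i. i \<in> I \<Longrightarrow> X i \<in> germ_span z S) \<Longrightarrow> (\<Sum>i\<in>I. X i) \<in> germ_span z S"
  by (induction I rule: infinite_finite_induct) (auto simp: germ_0 germ_add)

lemma germ_span_trans:
  assumes "X \<in> germ_span z S" "S \<subseteq> germ_span z S'" shows "X \<in> germ_span z S'"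
  using assms(1) by induction (use assms(2) in \<open>auto intro: germ_span.intros\<close>)

text \<open>Passes from the inductive closure to explicit coefficients: these are globally smooth,
  but the expansion holds only near \<open>z\<close>.\<close>

lemma germ_span_coefficients:
  assumes "X \<in> germ_span z S" "finite S"
  obtains a where "\<And>E. a E \<in> SF" "\<forall>\<^sub>F w in nhds z. X w = (\<Sum>E\<in>S. a E w *\<^sub>R E w)"
proof -
  from assms(1) have "\<exists>a. (\<forall>E. a E \<in> SF) \<and> (\<forall>\<^sub>F w in nhds z. X w = (\<Sum>E\<in>S. a E w *\<^sub>R E w))"
  proof induction
    case (germ_base E)
    have "(\<lambda>w. if F = E then 1 else (0::real)) \<in> SF" for F by (cases "F = E") (simp_all add: SF_const)
    moreover have "E w = (\<Sum>F\<in>S. (if F = E then 1 else 0) *\<^sub>R F w)" for w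
      using assms(2) germ_base by (simp add: if_distrib[of "\<lambda>a. a *\<^sub>R _"] cong: if_cong)
    ultimately show ?case by (intro exI[of _ "\<lambda>F w. if F = E then 1 else 0"]) auto
  next
    case germ_0
    show ?case by (intro exI[of _ "\<lambda>F w. 0"]) (simp add: SF_const zero_fun_apply)
  next
    case (germ_add X Y)
    then obtain a b where ab: "\<And>E. a E \<in> SF" "\<And>E. b E \<in> SF"
      and X: "\<forall>\<^sub>F w in nhds z. X w = (\<Sum>E\<in>S. a E w *\<^sub>R E w)"
      and Y: "\<forall>\<^sub>F w in nhds z. Y w = (\<Sum>E\<in>S. b E w *\<^sub>R E w)"
      by blast
    from X Y have "\<forall>\<^sub>F w in nhds z. (X + Y) w = (\<Sum>E\<in>S. (a E w + b E w) *\<^sub>R E w)"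
    proof eventually_elim
      case (elim w)
      show ?case unfolding plus_fun_apply[of X] elim by (simp add: scaleR_add_left sum.distrib)
    qed
    then show ?case using ab SF_add by (intro exI[of _ "\<lambda>E w. a E w + b E w"]) blast
  next
    case (germ_mult f X)
    then obtain a where "\<And>E. a E \<in> SF" "\<forall>\<^sub>F w in nhds z. X w = (\<Sum>E\<in>S. a E w *\<^sub>R E w)" by blast
    then show ?case using germ_mult(1)
      by (intro exI[of _ "\<lambda>E w. f w * a E w"])
        (auto simp: SF_mult scaleR_sum_right fun_mult_def elim: eventually_mono)
  next
    case (germ_cong X Y)
    then obtain a where "\<And>E. a E \<in> SF" "\<forall>\<^sub>F w in nhds z. X w = (\<Sum>E\<in>S. a E w *\<^sub>R E w)" by blast
    then show ?case using germ_cong(2)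
      by (intro exI[of _ a]) (auto elim: eventually_elim2)
  qed
  then show ?thesis using that by blast
qed

text \<open>The coefficient of \<open>E\<close> is a unit in the local ring of germs, so the
  expansion of \<open>X\<close> can be solved for \<open>E\<close>.\<close>

lemma germ_span_exchange:
  assumes S: "finite S" "E \<in> S" and a: "\<And>F. a F \<in> SF" "a E z \<noteq> 0"
    and X: "\<forall>\<^sub>F w in nhds z. X w = (\<Sum>F\<in>S. a F w *\<^sub>R F w)"
  shows "E \<in> germ_span z (insert X (S - {E}))"
proof -
  obtain b where b: "b \<in> SF" "\<forall>\<^sub>F w in nhds z. b w * a E w = 1"
    by (rule SF_local_inverse[OF a(1)[of E] a(2)])
  let ?Y = "fun_mult b X + (\<Sum>F\<in>S - {E}. fun_mult (\<lambda>w. (- 1) * (b w * a F w)) F)"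
  have "?Y \<in> germ_span z (insert X (S - {E}))"
    by (intro germ_add germ_mult germ_sum SF_mult SF_const a b germ_base) auto
  moreover have "\<forall>\<^sub>F w in nhds z. E w = ?Y w"
    using X b(2)
  proof eventually_elim
    case (elim w)
    have "b w *\<^sub>R X w = (b w * a E w) *\<^sub>R E w + (\<Sum>F\<in>S - {E}. (b w * a F w) *\<^sub>R F w)"
      by (simp add: elim(1) sum.remove[OF S] scaleR_add_right scaleR_sum_right)
    then show ?case using elim(2) by (simp add: sum_fun_apply fun_ops_apply fun_mult_def sum_negf)
  qed
  ultimately show ?thesis by (rule germ_cong)
qed

text \<open>Steinitz exchange over a local ring: independence at the single point \<open>z\<close>
  suffices, because a coefficient that is nonzero at \<open>z\<close> is a unit.\<close>

lemma germ_span_independent: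
  assumes J: "finite J" "J \<subseteq> VF" "\<And>c. (\<Sum>E\<in>J. c E *\<^sub>R E z) = 0 \<Longrightarrow> \<forall>E\<in>J. c E = 0"
    and B: "finite B" "VF \<subseteq> germ_span z B" "card B \<le> card J"
  shows "VF \<subseteq> germ_span z J"
proof -
  \<comment> \<open>Invariant of the exchange: each field of \<open>J\<close> takes the place of one
    old generator, and \<open>B'\<close> collects the generators still kept.\<close>
  have "\<exists>B'. finite B' \<and> card B' + card J \<le> card B \<and> VF \<subseteq> germ_span z (J \<union> B')"
    using J
  proof (induction J)
    case empty
    then show ?case using B by auto
  next
    case (insert X J)
    have ind: "\<forall>E\<in>J. c E = 0" if "(\<Sum>E\<in>J. c E *\<^sub>R E z) = 0" for c
    proof -
      have "(\<Sum>E\<in>insert X J. (c(X := 0)) E *\<^sub>R E z) = (\<Sum>E\<in>J. c E *\<^sub>R E z)"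
        using insert.hyps by (auto intro!: sum.cong)
      then have "\<forall>E\<in>insert X J. (c(X := 0)) E = 0" using insert.prems(2) that by presburger
      then show ?thesis using insert.hyps(2) by (metis fun_upd_other insertI2)
    qed
    have "\<exists>B'. finite B' \<and> card B' + card J \<le> card B \<and> VF \<subseteq> germ_span z (J \<union> B')"
      by (rule insert.IH[OF _ ind]) (use insert.prems(1) in auto)
    then obtain B'
      where B': "finite B'" "card B' + card J \<le> card B" "VF \<subseteq> germ_span z (J \<union> B')"
      by blast
    have fin: "finite (J \<union> B')" using insert.hyps B' by auto
    obtain a where a: "\<And>E. a E \<in> SF" "\<forall>\<^sub>F w in nhds z. X w = (\<Sum>E\<in>J \<union> B'. a E w *\<^sub>R E w)"
      using germ_span_coefficients[OF _ fin, of X z] B'(3) insert.prems(1) by blast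
    \<comment> \<open>Otherwise \<open>X z\<close> would be a combination of the values at
      \<open>z\<close> of fields in \<open>J\<close>, and the coefficient -1 for \<open>X\<close>
      would complete it to a forbidden relation.\<close>
    have "\<exists>E\<in>B' - J. a E z \<noteq> 0"
    proof (rule ccontr)
      assume "\<not> (\<exists>E\<in>B' - J. a E z \<noteq> 0)"
      then have "(\<Sum>E\<in>J \<union> B'. a E z *\<^sub>R E z) = (\<Sum>E\<in>J. a E z *\<^sub>R E z)"
        by (intro sum.mono_neutral_right fin) auto
      then have "X z = (\<Sum>E\<in>J. a E z *\<^sub>R E z)" using eventually_nhds_x_imp_x[OF a(2)] by simp
      moreover have "(\<Sum>E\<in>J. ((\<lambda>E. a E z)(X := -1)) E *\<^sub>R E z) = (\<Sum>E\<in>J. a E z *\<^sub>R E z)"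
        using insert.hyps by (intro sum.cong) auto
      ultimately have "(\<Sum>E\<in>insert X J. ((\<lambda>E. a E z)(X := -1)) E *\<^sub>R E z) = 0"
        using insert.hyps by simp
      from insert.prems(2)[OF this] show False by simp
    qed
    then obtain E where E: "E \<in> B'" "E \<notin> J" "a E z \<noteq> 0" by blast
    let ?S = "insert X J \<union> (B' - {E})"
    have "E \<in> germ_span z (insert X (J \<union> B' - {E}))"
      by (rule germ_span_exchange[OF fin _ a(1) E(3) a(2)]) (use E in auto)
    moreover have "insert X (J \<union> B' - {E}) = ?S" using E by auto
    ultimately have "J \<union> B' \<subseteq> germ_span z ?S" by (auto intro: germ_base)
    then have "VF \<subseteq> germ_span z ?S" using B'(3) germ_span_trans by blast
    moreover have "card (B' - {E}) + card (insert X J) \<le> card B"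
      using B' E insert.hyps card_Suc_Diff1[of B' E] by auto
    ultimately show ?case using B'(1) by (intro exI[of _ "B' - {E}"]) auto
  qed
  then obtain B' where "finite B'" "card B' + card J \<le> card B" "VF \<subseteq> germ_span z (J \<union> B')"
    by blast
  \<comment> \<open>Since \<open>B\<close> is no larger than \<open>J\<close>, no old generator is
    left over.\<close>
  moreover from this(2) B(3) have "card B' = 0" by linarith
  ultimately show ?thesis by simp
qed

lemma form_eqI:
  assumes "vector_one_form A P" "vector_one_form A Q"
    and "\<And>z u. u \<in> TS z \<Longrightarrow> P z u = Q z u"
  shows "P = Q"
  using assms form_outside by (intro ext) metis

end

subsection \<open>Almost tangent structures\<close>

locale almost_tangent_manifold = smooth_atlas A
  for A :: "('m::{t2_space, second_countable_topology}, 'e::euclidean_space) atlas" +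
  fixes n :: nat and L :: "'m form1"
  assumes dimension: "DIM('e) = 2 * n"
    and almost_tangent: "almost_tangent_structure A n L"
begin

section \<open>The vertical spaces and the dimension of the tangent spaces\<close>

abbreviation "VS \<equiv> vertical_space A L"

lemma L_form: "vector_one_form A L"
  and dim_VS: "dim (VS z) = n"
  and L_im_ker: "im_at A L z = ker_at A L z"
  using almost_tangent by (auto simp: almost_tangent_structure_def)

lemma VS_iff: "u \<in> VS z \<longleftrightarrow> u \<in> TS z \<and> L z u = 0"
  unfolding L_im_ker by (simp add: ker_at_def)

lemma VS_TS: "u \<in> VS z \<Longrightarrow> u \<in> TS z"
  by (simp add: VS_iff)

lemma L_VS: "u \<in> TS z \<Longrightarrow> L z u \<in> VS z"
  by (simp add: im_at_def)

lemma subspace_VS: "subspace (VS z)"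
  using subspace_TS by (auto simp: subspace_def VS_iff form_0[OF L_form] form_add[OF L_form] form_scale[OF L_form])

lemma VS_basis:
  obtains B where "finite B" "card B = n" "B \<subseteq> VS z" "independent B" "VS z \<subseteq> span B"
proof -
  obtain B where B: "B \<subseteq> VS z" "independent B" "VS z \<subseteq> span B" "card B = n"
    using basis_exists dim_VS by metis
  \<comment> \<open>Positivity of \<open>n\<close> gives finiteness of \<open>B\<close>, as an
    infinite set has \<open>card\<close> 0.\<close>
  moreover have "n > 0" using dimension DIM_positive[where 'a='e] by (metis mult_0_right neq0_conv)
  ultimately show ?thesis using that card_gt_0_iff by metis
qed

text \<open>Rank-nullity for \<open>L z\<close>. It spares the usual proof, by Hadamard's lemma, that the coordinate
  fields span the space of derivations.\<close>

lemma TS_finite_span: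
  obtains W where "finite W" "card W \<le> 2 * n" "TS z \<subseteq> span W"
proof -
  obtain B where B: "finite B" "card B = n" "B \<subseteq> VS z" "VS z \<subseteq> span B" using VS_basis by metis
  have "\<forall>b\<in>B. \<exists>y. y \<in> TS z \<and> L z y = b" using B(3) by (fastforce simp: im_at_def)
  then obtain y where y: "\<And>b. b \<in> B \<Longrightarrow> y b \<in> TS z \<and> L z (y b) = b" by metis
  show thesis
  proof
    show "finite (B \<union> y ` B)" using B by simp
    show "card (B \<union> y ` B) \<le> 2 * n"
      using B card_Un_le[of B "y ` B"] card_image_le[of B y] by linarith
    show "TS z \<subseteq> span (B \<union> y ` B)"
    proof
      fix u assume u: "u \<in> TS z"
      have "L z u \<in> span (id ` B)" using L_VS[OF u] B by auto
      then obtain c where c: "L z u = (\<Sum>b\<in>B. c b *\<^sub>R b)"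
        using span_family_sum[OF B(1), of "L z u" id] by auto
      let ?s = "\<Sum>b\<in>B. c b *\<^sub>R y b"
      have s: "?s \<in> TS z" using y by (intro subspace_sum subspace_scale subspace_TS) auto
      have "L z ?s = L z u"
        using y by (simp add: form_sum[OF L_form, of _ y] c)
      then have "u - ?s \<in> VS z"
        using u s by (simp add: VS_iff form_diff[OF L_form] subspace_diff[OF subspace_TS])
      then have "u - ?s \<in> span (B \<union> y ` B)" using B(4) span_mono[of B "B \<union> y ` B"] by blast
      moreover have "?s \<in> span (B \<union> y ` B)" by (intro span_sum span_scale span_base) auto
      ultimately have "(u - ?s) + ?s \<in> span (B \<union> y ` B)" by (rule span_add)
      then show "u \<in> span (B \<union> y ` B)" by simp
    qed
  qed
qed

section \<open>Coordinate fields as local generators\<close>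

text \<open>By duality the coordinate fields are \<open>2 * n\<close> independent vectors in a space
  spanned by at most \<open>2 * n\<close> vectors, so they span it. Applying a combination to
  \<open>x j\<close> reads off its coefficients.\<close>

lemma coordinate_basis:
  obtains E :: "'e \<Rightarrow> 'm field" and x :: "'e \<Rightarrow> 'm \<Rightarrow> real"
  where "\<And>i. E i \<in> VF" "\<And>i. x i \<in> SF"
    "\<forall>\<^sub>F w in nhds z. \<forall>u\<in>TS w. u = (\<Sum>i\<in>Basis. u (x i) *\<^sub>R E i w)"
proof -
  obtain E :: "'e \<Rightarrow> 'm field" and x :: "'e \<Rightarrow> 'm \<Rightarrow> real"
    where E: "\<And>i. E i \<in> VF" "\<And>i. x i \<in> SF"
    and ev: "\<forall>\<^sub>F w in nhds z. \<forall>i\<in>Basis. \<forall>j\<in>Basis. E i w (x j) = (if i = j then 1 else 0)"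
    by (rule coordinate_frame[of z]) blast
  from ev have "\<forall>\<^sub>F w in nhds z. \<forall>u\<in>TS w. u = (\<Sum>i\<in>Basis. u (x i) *\<^sub>R E i w)"
  proof eventually_elim
    case (elim w)
    have app: "(\<Sum>i\<in>Basis. c i *\<^sub>R E i w) (x j) = c j" if "j \<in> Basis" for c and j :: 'e
    proof -
      have "(\<Sum>i\<in>Basis. c i *\<^sub>R E i w) (x j) = (\<Sum>i\<in>Basis. if i = j then c i else 0)"
        unfolding sum_fun_apply using elim that by (intro sum.cong) (auto simp: fun_ops_apply)
      then show ?thesis using that by simp
    qed
    obtain W where W: "finite W" "card W \<le> 2 * n" "TS w \<subseteq> span W" using TS_finite_span by metis
    have "W \<subseteq> span ((\<lambda>i. E i w) ` Basis)"
    proof (rule independent_family_spans)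
      show "\<forall>i\<in>Basis. c i = 0" if "(\<Sum>i\<in>Basis. c i *\<^sub>R E i w) = 0" for c
        using app[of _ c] that by (simp add: zero_fun_apply)
      show "(\<lambda>i. E i w) ` Basis \<subseteq> span W" using W(3) VF_D(1)[OF E(1)] by auto
    qed (use W dimension in auto)
    then have TS: "TS w \<subseteq> span ((\<lambda>i. E i w) ` Basis)"
      using W(3) span_minimal[OF _ subspace_span] by blast
    show ?case
    proof
      fix u assume "u \<in> TS w"
      then obtain c where c: "u = (\<Sum>i\<in>Basis. c i *\<^sub>R E i w)"
        using TS span_family_sum[OF finite_Basis] by blast
      then have "u (x j) = c j" if "j \<in> Basis" for j using app that by blast
      then show "u = (\<Sum>i\<in>Basis. u (x i) *\<^sub>R E i w)" using c by (simp cong: sum.cong)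
    qed
  qed
  then show ?thesis using that E by blast
qed

text \<open>The extension has the constant coefficients \<open>u (x i)\<close> with respect to the
  coordinate fields.\<close>

lemma TS_extend:
  assumes "u \<in> TS z" obtains X where "X \<in> VF" "X z = u"
proof -
  obtain E :: "'e \<Rightarrow> 'm field" and x where E: "\<And>i. E i \<in> VF" "\<And>i. x i \<in> SF"
    "\<forall>\<^sub>F w in nhds z. \<forall>u\<in>TS w. u = (\<Sum>i\<in>Basis. u (x i) *\<^sub>R E i w)"
    by (rule coordinate_basis[of z]) blast
  show thesis
  proof
    show "(\<Sum>i\<in>Basis. u (x i) *\<^sub>R E i) \<in> VF" by (intro VF_sum VF_scale E)
    show "(\<Sum>i\<in>Basis. u (x i) *\<^sub>R E i) z = u"
      using eventually_nhds_x_imp_x[OF E(3)] assms by (simp add: sum_fun_apply fun_ops_apply)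
  qed
qed

text \<open>The coordinate fields serve: the coefficients of a field \<open>X\<close> are its values
  on the functions \<open>x i\<close>, hence smooth.\<close>

lemma VF_germ_basis:
  obtains B where "finite B" "card B \<le> 2 * n" "B \<subseteq> VF" "VF \<subseteq> germ_span z B"
    "\<forall>\<^sub>F w in nhds z. TS w \<subseteq> span ((\<lambda>E. E w) ` B)"
proof -
  obtain E :: "'e \<Rightarrow> 'm field" and x where E: "\<And>i. E i \<in> VF" "\<And>i. x i \<in> SF"
    and ev: "\<forall>\<^sub>F w in nhds z. \<forall>u\<in>TS w. u = (\<Sum>i\<in>Basis. u (x i) *\<^sub>R E i w)"
    by (rule coordinate_basis[of z]) blast
  show thesis
  proof
    show "card (E ` Basis) \<le> 2 * n" using card_image_le[of Basis E] dimension by simp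
    show "VF \<subseteq> germ_span z (E ` Basis)"
    proof
      fix X assume X: "X \<in> VF"
      have "(\<Sum>i\<in>Basis. fun_mult (\<lambda>w. X w (x i)) (E i)) \<in> germ_span z (E ` Basis)"
        by (intro germ_sum germ_mult germ_base VF_D[OF X] E imageI)
      then show "X \<in> germ_span z (E ` Basis)"
        by (rule germ_cong) (use ev VF_D(1)[OF X] in \<open>auto simp: sum_fun_apply fun_ops_apply fun_mult_def elim: eventually_mono\<close>)
    qed
    from ev show "\<forall>\<^sub>F w in nhds z. TS w \<subseteq> span ((\<lambda>X. X w) ` E ` Basis)"
    proof eventually_elim
      case (elim w)
      show ?case
      proof
        fix u assume "u \<in> TS w"
        then have "u = (\<Sum>i\<in>Basis. u (x i) *\<^sub>R E i w)" using elim by blast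
        also have "\<dots> \<in> span ((\<lambda>X. X w) ` E ` Basis)" by (intro span_sum span_scale span_base) auto
        finally show "u \<in> span ((\<lambda>X. X w) ` E ` Basis)" .
      qed
    qed
  qed (use E in auto)
qed

text \<open>The finitely many fields of a coordinate basis are combinations of \<open>J\<close> on a
  common neighbourhood, and they span the tangent spaces there.\<close>

lemma germ_span_spans_TS:
  assumes "finite J" "VF \<subseteq> germ_span z J"
  shows "\<forall>\<^sub>F w in nhds z. TS w \<subseteq> span ((\<lambda>E. E w) ` J)"
proof -
  obtain B where B: "finite B" "card B \<le> 2 * n" "B \<subseteq> VF" "VF \<subseteq> germ_span z B"
    "\<forall>\<^sub>F w in nhds z. TS w \<subseteq> span ((\<lambda>E. E w) ` B)"
    by (rule VF_germ_basis[of z])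
  have "\<forall>\<^sub>F w in nhds z. E w \<in> span ((\<lambda>E. E w) ` J)" if "E \<in> B" for E
  proof -
    have "E \<in> germ_span z J" using assms(2) B(3) that by blast
    then obtain a where "\<And>F. a F \<in> SF" "\<forall>\<^sub>F w in nhds z. E w = (\<Sum>F\<in>J. a F w *\<^sub>R F w)"
      by (rule germ_span_coefficients[OF _ assms(1)]) blast
    from this(2) show ?thesis
      by eventually_elim (auto intro!: span_sum span_scale intro: span_base)
  qed
  then have "\<forall>\<^sub>F w in nhds z. \<forall>E\<in>B. E w \<in> span ((\<lambda>E. E w) ` J)"
    using B(1) by (simp add: eventually_ball_finite)
  with B(5) show ?thesis
  proof eventually_elim
    case (elim w)
    then show ?case using span_minimal[OF _ subspace_span, of "(\<lambda>E. E w) ` B"] by blast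
  qed
qed

section \<open>Smooth local preimages of vertical fields\<close>

text \<open>Since the image of \<open>N\<close> is its kernel, applying \<open>N\<close> to a frame
  expansion of \<open>Y\<close> leaves only a relation among the \<open>N f\<close>. It is a zero
  relation because \<open>Y\<close> is vertical, so the coefficients of the \<open>f\<close> vanish
  near \<open>z\<close> and \<open>Y\<close> is \<open>N\<close> of an explicit combination of the
  \<open>f\<close>.\<close>

lemma local_lift:
  assumes N: "vector_one_form A N" "\<And>w. im_at A N w = VS w" "\<And>w. ker_at A N w = VS w"
    and Y: "Y \<in> VF" "\<And>w. Y w \<in> VS w"
  obtains X where "X \<in> VF" "\<forall>\<^sub>F w in nhds z. Y w = N w (X w)"
proof -
  have N_VS: "N w u \<in> VS w" if "u \<in> TS w" for w u
    using that N(2)[of w] by (auto simp: im_at_def)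
  have N0: "N w u = 0" if "u \<in> VS w" for w u using that N(3)[of w] by (auto simp: ker_at_def)
  obtain B where B: "finite B" "card B = n" "B \<subseteq> VS z" "independent B" using VS_basis by metis
  \<comment> \<open>Preimages under \<open>N\<close> of a basis of the vertical space at
    \<open>z\<close>, extended to global fields.\<close>
  have "\<exists>F\<in>VF. N z (F z) = b" if "b \<in> B" for b
  proof -
    have "b \<in> im_at A N z" using that B(3) N(2) by blast
    then obtain y where y: "y \<in> TS z" "N z y = b" by (auto simp: im_at_def)
    then show ?thesis using TS_extend[OF y(1)] by metis
  qed
  then obtain F where F: "\<And>b. b \<in> B \<Longrightarrow> F b \<in> VF" "\<And>b. b \<in> B \<Longrightarrow> N z (F b z) = b" by metis
  define J where "J = F ` B"
  have inj: "inj_on F B" using F(2) by (metis inj_onI)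
  have J: "finite J" "card J = n" "J \<subseteq> VF" using B F by (auto simp: J_def card_image[OF inj])
  have ind: "\<forall>f\<in>J. c f = 0" if "(\<Sum>f\<in>J. c f *\<^sub>R N z (f z)) = 0" for c
  proof -
    have "(\<Sum>b\<in>B. c (F b) *\<^sub>R N z (F b z)) = 0"
      using that by (simp add: J_def sum.reindex[OF inj])
    then have "(\<Sum>b\<in>B. c (F b) *\<^sub>R b) = 0" using F(2) by simp
    then have "c (F b) = 0" if "b \<in> B" for b
      using independentD[OF B(4,1) order_refl, of "\<lambda>b. c (F b)"] that by blast
    then show ?thesis by (simp add: J_def)
  qed
  have TSJ: "f w \<in> TS w" if "f \<in> J" for f w using that J(3) VF_D(1) by blast
  \<comment> \<open>The frame is a set of fields. Injectivity of \<open>N\<close> on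
    \<open>J\<close> and disjointness, both tested at \<open>z\<close>, ensure that it has
    \<open>2 * n\<close> elements and that sums over it split.\<close>
  have injN: "inj_on ((\<cdot>) N) J"
  proof (rule inj_onI)
    fix f g assume fg: "f \<in> J" "g \<in> J" "N \<cdot> f = N \<cdot> g"
    then obtain b c where bc: "b \<in> B" "c \<in> B" "f = F b" "g = F c" by (auto simp: J_def)
    have "N z (f z) = N z (g z)" using fun_cong[OF fg(3), of z] by (simp add: form_app_def)
    then show "f = g" using F(2) bc by simp
  qed
  have disj: "J \<inter> (\<cdot>) N ` J = {}"
  proof (rule ccontr)
    assume "J \<inter> (\<cdot>) N ` J \<noteq> {}"
    then obtain f g where fg: "f \<in> J" "g \<in> J" "f = N \<cdot> g" by auto
    then have "N z (f z) = 0" using N0 N_VS TSJ by (simp add: form_app_def)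
    moreover have "N z (f z) \<in> B" using fg(1) F(2) by (auto simp: J_def)
    ultimately show False using B(4) dependent_zero by metis
  qed
  let ?J = "J \<union> (\<cdot>) N ` J"
  have split: "(\<Sum>g\<in>?J. G g) = (\<Sum>f\<in>J. G f) + (\<Sum>f\<in>J. G (N \<cdot> f))" for G :: "'m field \<Rightarrow> 'm tvec"
    using J(1) disj by (simp add: sum.union_disjoint sum.reindex[OF injN])
  have applyN: "N w (\<Sum>g\<in>?J. c g *\<^sub>R g w) = (\<Sum>f\<in>J. c f *\<^sub>R N w (f w))" for c w
  proof -
    have "g w \<in> TS w" if "g \<in> ?J" for g
      using that TSJ form_TS[OF N(1)] by (auto simp: form_app_def)
    then have "N w (\<Sum>g\<in>?J. c g *\<^sub>R g w) = (\<Sum>g\<in>?J. c g *\<^sub>R N w (g w))"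
      by (rule form_sum[OF N(1)])
    then show ?thesis using N0 N_VS TSJ unfolding split by (simp add: form_app_def)
  qed
  obtain C where C: "finite C" "card C \<le> 2 * n" "VF \<subseteq> germ_span z C" using VF_germ_basis by metis
  have gen: "VF \<subseteq> germ_span z ?J"
  proof (rule germ_span_independent[OF _ _ _ C(1,3)])
    show "?J \<subseteq> VF" using J(3) form_VF[OF N(1)] by auto
    show "card C \<le> card ?J" using C(2) J disj by (simp add: card_Un_disjoint card_image[OF injN])
    \<comment> \<open>Applying \<open>N\<close> to the relation removes the fields
      \<open>N f\<close>, so the coefficients on \<open>J\<close> vanish; what remains is again a
      relation among the vectors \<open>N z (f z)\<close>.\<close>
    fix c assume c: "(\<Sum>g\<in>?J. c g *\<^sub>R g z) = 0"
    then have "(\<Sum>f\<in>J. c f *\<^sub>R N z (f z)) = 0"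
      using applyN[of z c] form_0[OF N(1), of z] by simp
    then have c0: "\<forall>f\<in>J. c f = 0" by (rule ind)
    then have "(\<Sum>f\<in>J. c (N \<cdot> f) *\<^sub>R N z (f z)) = 0" using c unfolding split by (simp add: form_app_def)
    then have "\<forall>f\<in>J. c (N \<cdot> f) = 0" by (rule ind)
    with c0 show "\<forall>g\<in>?J. c g = 0" by auto
  qed (use J in auto)
  obtain a where a: "\<And>g. a g \<in> SF" "\<forall>\<^sub>F w in nhds z. Y w = (\<Sum>g\<in>?J. a g w *\<^sub>R g w)"
    using germ_span_coefficients[of Y z ?J] gen Y(1) J(1) by blast
  have "\<forall>\<^sub>F w in nhds z. TS w \<subseteq> span ((\<lambda>g. g w) ` ?J)"
    by (rule germ_span_spans_TS[OF _ gen]) (use J in auto)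
  then have "\<forall>\<^sub>F w in nhds z. Y w = N w ((\<Sum>f\<in>J. fun_mult (a (N \<cdot> f)) f) w)"
    using a(2)
  proof eventually_elim
    case (elim w)
    \<comment> \<open>At nearby points \<open>w\<close>, spanning is inherited from the frame. As
      \<open>n\<close> vectors spanning a space of dimension \<open>n\<close>, the
      \<open>N w (f w)\<close> are then independent at \<open>w\<close>, not only at
      \<open>z\<close>.\<close>
    have "VS w \<subseteq> span ((\<lambda>f. N w (f w)) ` J)"
    proof
      fix v assume "v \<in> VS w"
      then have "v \<in> im_at A N w" using N(2) by blast
      then obtain u where u: "u \<in> TS w" "v = N w u" by (auto simp: im_at_def)
      then obtain c where "u = (\<Sum>g\<in>?J. c g *\<^sub>R g w)"
        using elim(1) span_family_sum[of ?J u "\<lambda>g. g w"] J(1) by blast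
      then have "v = (\<Sum>f\<in>J. c f *\<^sub>R N w (f w))" using applyN u by simp
      also have "\<dots> \<in> span ((\<lambda>f. N w (f w)) ` J)" by (intro span_sum span_scale span_base) auto
      finally show "v \<in> span ((\<lambda>f. N w (f w)) ` J)" .
    qed
    then have "\<forall>f\<in>J. a f w = 0" if "(\<Sum>f\<in>J. a f w *\<^sub>R N w (f w)) = 0"
      using spanning_family_independent[OF J(1) _ _ that] dim_VS J(2) by simp
    moreover have "(\<Sum>f\<in>J. a f w *\<^sub>R N w (f w)) = 0"
      using applyN[of w "\<lambda>g. a g w"] N0[OF Y(2), of w] unfolding elim(2)[symmetric] by simp
    ultimately have "\<forall>f\<in>J. a f w = 0" by blast
    then have "Y w = (\<Sum>f\<in>J. a (N \<cdot> f) w *\<^sub>R N w (f w))"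
      using elim(2) unfolding split by (simp add: form_app_def)
    also have "\<dots> = N w (\<Sum>f\<in>J. a (N \<cdot> f) w *\<^sub>R f w)"
      using form_sum[OF N(1), of J "\<lambda>f. f w"] TSJ by simp
    finally show ?case by (simp add: sum_fun_apply fun_ops_apply fun_mult_def)
  qed
  moreover have "(\<Sum>f\<in>J. fun_mult (a (N \<cdot> f)) f) \<in> VF"
    using J(3) a(1) by (intro VF_sum VF_mult) auto
  ultimately show ?thesis using that by blast
qed

section \<open>Function-linear operators as vector 1-forms\<close>

text \<open>Function-linearity makes \<open>T X z\<close> depend on \<open>X z\<close> alone: first
  on the germ of \<open>X\<close>, then on its value. The fibre map is then obtained by extending a
  tangent vector to any field.\<close>

lemma tensorial_form:
  assumes VF: "\<And>X. X \<in> VF \<Longrightarrow> T X \<in> VF"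
    and add: "\<And>X Y. X \<in> VF \<Longrightarrow> Y \<in> VF \<Longrightarrow> T (X + Y) = T X + T Y"
    and mult: "\<And>f X. f \<in> SF \<Longrightarrow> X \<in> VF \<Longrightarrow> T (fun_mult f X) = fun_mult f (T X)"
  shows "\<exists>!K. vector_one_form A K \<and> (\<forall>X\<in>VF. K \<cdot> X = T X)"
proof (rule ex_ex1I)
  have T0: "T 0 = 0" using add[OF VF_0 VF_0] by simp
  have sum: "T (\<Sum>i\<in>I. X i) = (\<Sum>i\<in>I. T (X i))" if "\<And>i. X i \<in> VF" for X :: "'e \<Rightarrow> 'm field" and I
    by (induction I rule: infinite_finite_induct) (auto simp: T0 add that VF_sum)
  \<comment> \<open>A bump function supported in the set of agreement makes the two fields equal
    everywhere without changing \<open>T X\<close> and \<open>T Y\<close> at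
    \<open>z\<close>.\<close>
  have local: "T X z = T Y z" if XY: "X \<in> VF" "Y \<in> VF" and ev: "\<forall>\<^sub>F w in nhds z. X w = Y w" for X Y z
  proof -
    obtain W where W: "open W" "z \<in> W" "\<And>w. w \<in> W \<Longrightarrow> X w = Y w"
      using ev unfolding eventually_nhds by blast
    obtain \<rho> where \<rho>: "\<rho> \<in> SF" "\<forall>\<^sub>F w in nhds z. \<rho> w = 1" "\<And>w. w \<notin> W \<Longrightarrow> \<rho> w = 0"
      using SF_bump[OF W(1,2)] by metis
    have "fun_mult \<rho> X = fun_mult \<rho> Y"
      unfolding fun_mult_def using W(3) \<rho>(3) by (metis scaleR_zero_left)
    then have "fun_mult \<rho> (T X) z = fun_mult \<rho> (T Y) z" using mult \<rho>(1) XY by metis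
    then show ?thesis using eventually_nhds_x_imp_x[OF \<rho>(2)] by (simp add: fun_mult_def)
  qed
  \<comment> \<open>Locality allows \<open>Z\<close> to be replaced by its coordinate expansion,
    after which only the values of its coefficients at \<open>z\<close> enter.\<close>
  have pt: "T X z = T Y z" if XY: "X \<in> VF" "Y \<in> VF" "X z = Y z" for X Y z
  proof -
    obtain E :: "'e \<Rightarrow> 'm field" and x where E: "\<And>i. E i \<in> VF" "\<And>i. x i \<in> SF"
      and ev: "\<forall>\<^sub>F w in nhds z. \<forall>u\<in>TS w. u = (\<Sum>i\<in>Basis. u (x i) *\<^sub>R E i w)"
      by (rule coordinate_basis[of z]) blast
    have "T Z z = (\<Sum>i\<in>Basis. Z z (x i) *\<^sub>R T (E i) z)" if Z: "Z \<in> VF" for Z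
    proof -
      have c: "(\<lambda>w. Z w (x i)) \<in> SF" for i by (rule VF_D(2)[OF Z E(2)])
      have "\<forall>\<^sub>F w in nhds z. Z w = (\<Sum>i\<in>Basis. fun_mult (\<lambda>w. Z w (x i)) (E i)) w"
        using ev VF_D(1)[OF Z] by (auto simp: sum_fun_apply fun_mult_def elim: eventually_mono)
      then have "T Z z = T (\<Sum>i\<in>Basis. fun_mult (\<lambda>w. Z w (x i)) (E i)) z"
        by (intro local Z VF_sum VF_mult c E)
      also have "\<dots> = (\<Sum>i\<in>Basis. fun_mult (\<lambda>w. Z w (x i)) (T (E i))) z"
        by (simp add: sum VF_mult c E mult)
      finally show ?thesis by (simp add: sum_fun_apply fun_ops_apply fun_mult_def)
    qed
    then show ?thesis using XY by simp
  qed
  define ex where "ex z u = (SOME X. X \<in> VF \<and> X z = u)" for z u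
  have ex: "ex z u \<in> VF \<and> ex z u z = u" if u: "u \<in> TS z" for z u
  proof -
    obtain X where "X \<in> VF" "X z = u" by (rule TS_extend[OF u])
    then show ?thesis unfolding ex_def using someI[of "\<lambda>X. X \<in> VF \<and> X z = u" X] by simp
  qed
  define K where "K z u = (if u \<in> TS z then T (ex z u) z else 0)" for z u
  have K: "K z (X z) = T X z" if X: "X \<in> VF" for X z
    using ex[OF VF_D(1)[OF X]] pt[OF _ X] by (simp add: K_def VF_D(1)[OF X])
  have "vector_one_form A K"
    unfolding vector_one_form_def
  proof (intro conjI allI ballI impI)
    fix z u assume u: "u \<in> TS z"
    then obtain X where X: "X \<in> VF" "X z = u" by (rule TS_extend)
    show "K z u \<in> TS z" using K[OF X(1)] VF_D(1)[OF VF[OF X(1)]] X(2) by metis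
    show "K z (c *\<^sub>R u) = c *\<^sub>R K z u" for c
    proof -
      have "K z (fun_mult (\<lambda>_. c) X z) = fun_mult (\<lambda>_. c) (T X) z"
        using K[OF VF_mult[OF SF_const X(1)]] mult[OF SF_const X(1)] by simp
      then show ?thesis using K[OF X(1), of z] X(2) by (simp add: fun_mult_def)
    qed
    fix w assume "w \<in> TS z"
    then obtain Y where Y: "Y \<in> VF" "Y z = w" by (rule TS_extend)
    show "K z (u + w) = K z u + K z w"
      using K[OF VF_add[OF X(1) Y(1)], of z] K[OF X(1), of z] K[OF Y(1), of z] X(2) Y(2)
      unfolding add[OF X(1) Y(1)] plus_fun_apply[of X] plus_fun_apply[of "T X"] by simp
  next
    show "K z u = 0" if "u \<notin> TS z" for z u using that by (simp add: K_def)
    show "K \<cdot> X \<in> VF" if "X \<in> VF" for X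
      using VF[OF that] K[OF that] by (simp add: form_app_def)
  qed
  then show "\<exists>K. vector_one_form A K \<and> (\<forall>X\<in>VF. K \<cdot> X = T X)"
    using K by (auto simp: form_app_def)
next
  fix P Q
  assume P: "vector_one_form A P \<and> (\<forall>X\<in>VF. P \<cdot> X = T X)"
    and Q: "vector_one_form A Q \<and> (\<forall>X\<in>VF. Q \<cdot> X = T X)"
  show "P = Q"
  proof (rule form_eqI)
    fix z u assume "u \<in> TS z"
    then obtain X where X: "X \<in> VF" "X z = u" by (rule TS_extend)
    then have "(P \<cdot> X) z = (Q \<cdot> X) z" using P Q by simp
    then show "P z u = Q z u" using X by (simp add: form_app_def)
  qed (use P Q in auto)
qed

end

subsection \<open>Regular connections\<close>

locale regular_connection = almost_tangent_manifold A n L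
  for A :: "('m::{t2_space, second_countable_topology}, 'e::euclidean_space) atlas"
    and n L +
  fixes C :: "'m field" and D :: "'m field \<Rightarrow> 'm field \<Rightarrow> 'm field"
  assumes canonical: "canonical_field A L C"
    and regular: "L_regular A L C D"
begin

abbreviation "K \<equiv> connection_map A C D"
abbreviation "v \<equiv> vertical_projector A L C D"
abbreviation "h \<equiv> horizontal_projector A L C D"

section \<open>The connection map of a regular connection\<close>

lemma C_VF: "C \<in> VF" and C_VS: "C z \<in> VS z"
  using canonical by (auto simp: canonical_field_def)

lemma connection: "linear_connection A D"
  and D_L: "X \<in> VF \<Longrightarrow> Y \<in> VF \<Longrightarrow> D X (L \<cdot> Y) = L \<cdot> D X Y"
  and K_bij: "bij_betw (K z) (VS z) (VS z)"
  using regular by (auto simp: L_regular_def L_almost_tangent_def)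

lemma D_VF: "X \<in> VF \<Longrightarrow> Y \<in> VF \<Longrightarrow> D X Y \<in> VF"
  and D_add_left: "X \<in> VF \<Longrightarrow> X' \<in> VF \<Longrightarrow> Y \<in> VF \<Longrightarrow> D (X + X') Y = D X Y + D X' Y"
  and D_mult_left: "f \<in> SF \<Longrightarrow> X \<in> VF \<Longrightarrow> Y \<in> VF \<Longrightarrow> D (fun_mult f X) Y = fun_mult f (D X Y)"
  and D_add_right: "X \<in> VF \<Longrightarrow> Y \<in> VF \<Longrightarrow> Y' \<in> VF \<Longrightarrow> D X (Y + Y') = D X Y + D X Y'"
  using connection unfolding linear_connection_def by blast+

text \<open>Function-linearity of \<open>D\<close> in its first argument gives unique existence
  through \<open>tensorial_form\<close>, so the description defining \<open>K\<close>
  denotes.\<close>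

lemma K_form: "vector_one_form A K" and K_app: "X \<in> VF \<Longrightarrow> K \<cdot> X = D X C"
proof -
  have "\<exists>!K. vector_one_form A K \<and> (\<forall>X\<in>VF. K \<cdot> X = D X C)"
    by (rule tensorial_form) (simp_all add: D_VF D_add_left D_mult_left C_VF)
  from theI'[OF this] show "vector_one_form A K" "X \<in> VF \<Longrightarrow> K \<cdot> X = D X C"
    unfolding connection_map_def by blast+
qed

text \<open>As \<open>C\<close> is vertical, \<open>L C = 0\<close>; since \<open>D\<close> commutes
  with \<open>L\<close>, also \<open>L (D X C) = D X (L C) = 0\<close>, and the kernel of
  \<open>L\<close> is the vertical bundle.\<close>

lemma K_VS:
  assumes "u \<in> TS z" shows "K z u \<in> VS z"
proof -
  obtain X where X: "X \<in> VF" "X z = u" using assms by (rule TS_extend)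
  have "L \<cdot> C = 0" using C_VS by (simp add: form_app_def VS_iff fun_eq_iff zero_fun_apply)
  moreover have "D X 0 = 0" using D_add_right[OF X(1) VF_0 VF_0] by simp
  ultimately have "L \<cdot> D X C = 0" using D_L[OF X(1) C_VF] by simp
  then have "(L \<cdot> D X C) z = 0" by (simp add: zero_fun_apply)
  then have "L z (D X C z) = 0" by (simp add: form_app_def)
  moreover have "K z u = D X C z" using fun_cong[OF K_app[OF X(1)], of z] X(2) by (simp add: form_app_def)
  ultimately show ?thesis using form_TS[OF K_form assms] by (simp add: VS_iff)
qed

section \<open>The vertical and horizontal projectors\<close>

lemma v_VS: "u \<in> TS z \<Longrightarrow> v z u \<in> VS z"
  and K_v: "u \<in> TS z \<Longrightarrow> K z (v z u) = K z u"
proof -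
  assume "u \<in> TS z"
  then have "K z u \<in> K z ` VS z" using K_VS K_bij by (metis bij_betw_imp_surj_on)
  then show "v z u \<in> VS z" "K z (v z u) = K z u"
    by (simp_all add: vertical_projector_def form_comp_def phi_map_def inv_into_into f_inv_into_f)
qed

text \<open>Injectivity of \<open>K\<close> on vertical vectors makes \<open>v z u\<close> the only
  vertical solution; linearity of \<open>v\<close> and its values on vertical and horizontal vectors
  are read off from this.\<close>

lemma v_eqI: "u \<in> TS z \<Longrightarrow> w \<in> VS z \<Longrightarrow> K z w = K z u \<Longrightarrow> v z u = w"
  using K_bij[of z] v_VS K_v by (metis bij_betw_imp_inj_on inj_onD)

lemma v_TS: "u \<in> TS z \<Longrightarrow> v z u \<in> TS z"
  using v_VS VS_TS by blast

lemma v_vertical: "u \<in> VS z \<Longrightarrow> v z u = u"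
  using VS_TS by (intro v_eqI) auto

lemma v_add: "u \<in> TS z \<Longrightarrow> w \<in> TS z \<Longrightarrow> v z (u + w) = v z u + v z w"
  by (rule v_eqI)
    (simp_all add: TS_add subspace_add[OF subspace_VS] v_VS form_add[OF K_form] v_TS K_v)

lemma v_scale: "u \<in> TS z \<Longrightarrow> v z (c *\<^sub>R u) = c *\<^sub>R v z u"
  by (rule v_eqI)
    (simp_all add: TS_scale subspace_scale[OF subspace_VS] v_VS form_scale[OF K_form] v_TS K_v)

text \<open>Wherever \<open>K X = K (L Y)\<close> one has \<open>v X = L Y\<close>; the local solutions \<open>Y\<close> are smooth by the lifting
  lemma for \<open>K \<odot> L\<close>, which has the same image and kernel as \<open>L\<close>.\<close>

lemma v_VF:
  assumes X: "X \<in> VF" shows "v \<cdot> X \<in> VF"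
proof (rule VF_local)
  fix z
  let ?N = "K \<odot> L"
  have N: "vector_one_form A ?N" by (rule form_comp_form[OF K_form L_form])
  have im: "im_at A ?N w = VS w" for w
    using bij_betw_imp_surj_on[OF K_bij, of w] by (auto simp: im_at_def form_comp_def image_image)
  have ker: "ker_at A ?N w = VS w" for w
  proof -
    have "K w (L w u) = 0 \<longleftrightarrow> L w u = 0" if "u \<in> TS w" for u
      using bij_betw_imp_inj_on[OF K_bij, of w] form_0[OF K_form, of w] L_VS[OF that]
        subspace_0[OF subspace_VS, of w] by (metis inj_onD)
    then show ?thesis by (auto simp: ker_at_def form_comp_def VS_iff form_0[OF K_form])
  qed
  have KX: "K \<cdot> X \<in> VF" "\<And>w. (K \<cdot> X) w \<in> VS w"
    using form_VF[OF K_form X] K_VS VF_D(1)[OF X] by (auto simp: form_app_def)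
  obtain Y where Y: "Y \<in> VF" "\<forall>\<^sub>F w in nhds z. (K \<cdot> X) w = ?N w (Y w)"
    by (rule local_lift[OF N im ker KX, of z]) blast
  from Y(2) have "\<forall>\<^sub>F w in nhds z. (v \<cdot> X) w = (L \<cdot> Y) w"
    by eventually_elim
      (simp add: form_app_def form_comp_def v_eqI VF_D(1)[OF X] VF_D(1)[OF Y(1)] L_VS)
  then show "\<exists>Z\<in>VF. \<forall>\<^sub>F w in nhds z. (v \<cdot> X) w = Z w" using form_VF[OF L_form Y(1)] by blast
qed

lemma h_eq: "h z u = u - v z u"
  by (simp add: horizontal_projector_def)

lemma h_TS: "u \<in> TS z \<Longrightarrow> h z u \<in> TS z"
  by (simp add: h_eq v_TS subspace_diff[OF subspace_TS])

lemma h_vertical: "u \<in> VS z \<Longrightarrow> h z u = 0"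
  by (simp add: h_eq v_vertical)

lemma h_add: "u \<in> TS z \<Longrightarrow> w \<in> TS z \<Longrightarrow> h z (u + w) = h z u + h z w"
  by (simp add: h_eq v_add)

lemma h_scale: "u \<in> TS z \<Longrightarrow> h z (c *\<^sub>R u) = c *\<^sub>R h z u"
  by (simp add: h_eq v_scale scaleR_diff_right)

lemma h_diff: "u \<in> TS z \<Longrightarrow> w \<in> TS z \<Longrightarrow> h z (u - w) = h z u - h z w"
  using h_add[of u z "(-1) *\<^sub>R w"] h_scale[of w z "-1"] TS_scale[of w z "-1"] by simp

lemma h_VF: "X \<in> VF \<Longrightarrow> h \<cdot> X \<in> VF"
proof -
  assume "X \<in> VF"
  moreover have "h \<cdot> X = X - v \<cdot> X" by (rule ext) (simp add: form_app_def h_eq minus_apply[of X])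
  ultimately show ?thesis using v_VF VF_diff by simp
qed

lemma L_h: "u \<in> TS z \<Longrightarrow> L z (h z u) = L z u"
  using v_VS[of u z] by (simp add: h_eq form_diff[OF L_form] v_TS VS_iff)

text \<open>\<open>K\<close> sends \<open>u\<close> and \<open>v z u\<close> to the same vector,
  hence kills \<open>h z u\<close>; the vertical vector with the same image is 0.\<close>

lemma v_h: "u \<in> TS z \<Longrightarrow> v z (h z u) = 0"
  using form_diff[OF K_form, of u z "v z u"]
  by (intro v_eqI h_TS)
    (simp_all add: subspace_0[OF subspace_VS] form_0[OF K_form] h_eq v_TS K_v)

section \<open>The horizontal lift of the vertical part\<close>

text \<open>The horizontal lift of the vertical part: \<open>J (L X) = h X\<close> and \<open>J (h X) = 0\<close>, so that
  \<open>G = L - J\<close> and \<open>H = L + J\<close>.\<close>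

definition J :: "'m form1" where
  "J z u = (if u \<in> TS z then h z (SOME y. y \<in> TS z \<and> L z y = v z u) else 0)"

text \<open>Two admissible choices of \<open>y\<close> differ by a vertical vector, which
  \<open>h\<close> annihilates.\<close>

lemma J_eqI:
  assumes "u \<in> TS z" "y \<in> TS z" "L z y = v z u"
  shows "J z u = h z y"
proof -
  define y' where "y' = (SOME y. y \<in> TS z \<and> L z y = v z u)"
  have y': "y' \<in> TS z \<and> L z y' = v z u"
    unfolding y'_def by (rule someI[of _ y]) (use assms in simp)
  have "y' - y \<in> VS z"
    using y' assms by (simp add: VS_iff form_diff[OF L_form] subspace_diff[OF subspace_TS])
  then have "h z y' = h z y" using h_diff[of y' z y] y' assms(2) h_vertical by simp
  then show ?thesis using assms(1) by (simp add: J_def y'_def)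
qed

lemma v_lift:
  assumes "u \<in> TS z" obtains y where "y \<in> TS z" "L z y = v z u"
  using v_VS[OF assms] unfolding im_at_def by auto

text \<open>Linearity follows by adding and scaling preimages \<open>y\<close> and using
  independence of the choice. For smoothness, \<open>local_lift\<close> with \<open>N = L\<close>
  supplies the preimages of \<open>v X\<close> as a smooth field \<open>Y\<close> near each point,
  where \<open>J X\<close> then equals \<open>h Y\<close>.\<close>

lemma J_form: "vector_one_form A J"
  unfolding vector_one_form_def
proof (intro conjI allI ballI impI)
  fix z u assume u: "u \<in> TS z"
  obtain y where y: "y \<in> TS z" "L z y = v z u" using u by (rule v_lift)
  show "J z u \<in> TS z" using J_eqI[OF u y] h_TS[OF y(1)] by simp
  show "J z (c *\<^sub>R u) = c *\<^sub>R J z u" for c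
    unfolding J_eqI[OF u y] h_scale[OF y(1), symmetric]
    by (rule J_eqI) (simp_all add: TS_scale u y form_scale[OF L_form] v_scale)
  fix w assume w: "w \<in> TS z"
  obtain x where x: "x \<in> TS z" "L z x = v z w" using w by (rule v_lift)
  show "J z (u + w) = J z u + J z w"
    unfolding J_eqI[OF u y] J_eqI[OF w x] h_add[OF y(1) x(1), symmetric]
    by (rule J_eqI) (simp_all add: TS_add u y w x form_add[OF L_form] v_add)
next
  show "J z u = 0" if "u \<notin> TS z" for z u using that by (simp add: J_def)
  fix X assume X: "X \<in> VF"
  show "J \<cdot> X \<in> VF"
  proof (rule VF_local)
    fix z
    have vX: "\<And>w. (v \<cdot> X) w \<in> VS w" using v_VS VF_D(1)[OF X] by (simp add: form_app_def)
    obtain Y where Y: "Y \<in> VF" "\<forall>\<^sub>F w in nhds z. (v \<cdot> X) w = L w (Y w)"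
      by (rule local_lift[OF L_form refl L_im_ker[symmetric] v_VF[OF X] vX, of z]) blast
    from Y(2) have "\<forall>\<^sub>F w in nhds z. (J \<cdot> X) w = (h \<cdot> Y) w"
      by eventually_elim (simp add: form_app_def J_eqI VF_D(1)[OF X] VF_D(1)[OF Y(1)])
    then show "\<exists>Z\<in>VF. \<forall>\<^sub>F w in nhds z. (J \<cdot> X) w = Z w" using h_VF[OF Y(1)] by blast
  qed
qed

lemma J_L: "u \<in> TS z \<Longrightarrow> J z (L z u) = h z u"
  by (rule J_eqI) (simp_all add: form_TS[OF L_form] v_vertical L_VS)

lemma J_h: "u \<in> TS z \<Longrightarrow> J z (h z u) = 0"
  using J_eqI[of "h z u" z 0] h_vertical[OF subspace_0[OF subspace_VS], of z]
  by (simp add: h_TS TS_0 form_0[OF L_form] v_h)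

lemma L_L: "u \<in> TS z \<Longrightarrow> L z (L z u) = 0"
  using L_VS VS_iff by blast

section \<open>Existence and uniqueness of \<open>G\<close> and \<open>H\<close>, and their
  composite\<close>

text \<open>The identities defining \<open>G\<close> are the case \<open>c = -1\<close>, those defining \<open>H\<close> the case \<open>c = 1\<close>.\<close>

lemma field_identities_iff:
  assumes P: "vector_one_form A P"
  shows "(\<forall>X\<in>VF. P \<cdot> L \<cdot> X = c *\<^sub>R (h \<cdot> X) \<and> P \<cdot> h \<cdot> X = L \<cdot> X) \<longleftrightarrow>
    (\<forall>z. \<forall>u\<in>TS z. P z (L z u) = c *\<^sub>R h z u \<and> P z (h z u) = L z u)"
    (is "?l \<longleftrightarrow> ?r")
proof
  assume l: ?l
  show ?r
  proof (intro allI ballI)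
    fix z u assume "u \<in> TS z"
    then obtain X where X: "X \<in> VF" "X z = u" by (rule TS_extend)
    have "(P \<cdot> L \<cdot> X) z = (c *\<^sub>R (h \<cdot> X)) z" "(P \<cdot> h \<cdot> X) z = (L \<cdot> X) z"
      using l X(1) by simp_all
    then show "P z (L z u) = c *\<^sub>R h z u \<and> P z (h z u) = L z u"
      unfolding scaleR_fun_apply[of c "h \<cdot> X"] unfolding form_app_def X(2) by simp
  qed
next
  assume r: ?r
  show ?l
  proof
    fix X assume X: "X \<in> VF"
    have "(P \<cdot> L \<cdot> X) z = (c *\<^sub>R (h \<cdot> X)) z" "(P \<cdot> h \<cdot> X) z = (L \<cdot> X) z" for z
      unfolding scaleR_fun_apply[of c "h \<cdot> X"] unfolding form_app_def using r VF_D(1)[OF X] by blast+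
    then show "P \<cdot> L \<cdot> X = c *\<^sub>R (h \<cdot> X) \<and> P \<cdot> h \<cdot> X = L \<cdot> X" by (auto intro!: ext)
  qed
qed

lemma is_G_iff:
  "is_G A L C D G \<longleftrightarrow> vector_one_form A G \<and>
    (\<forall>z. \<forall>u\<in>TS z. G z (L z u) = (-1) *\<^sub>R h z u \<and> G z (h z u) = L z u)"
  using field_identities_iff[of G "-1"] by (auto simp: is_G_def Let_def)

lemma is_H_iff:
  "is_H A L C D H \<longleftrightarrow> vector_one_form A H \<and>
    (\<forall>z. \<forall>u\<in>TS z. H z (L z u) = 1 *\<^sub>R h z u \<and> H z (h z u) = L z u)"
  using field_identities_iff[of H 1] by (auto simp: is_H_def Let_def)

text \<open>Every tangent vector is \<open>v z u + h z u\<close>, and its vertical part is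
  \<open>L z y\<close> for some \<open>y\<close>.\<close>

lemma form_unique:
  assumes "vector_one_form A P" "vector_one_form A Q"
    and "\<And>z u. u \<in> TS z \<Longrightarrow> P z (L z u) = Q z (L z u)"
    and "\<And>z u. u \<in> TS z \<Longrightarrow> P z (h z u) = Q z (h z u)"
  shows "P = Q"
proof (rule form_eqI[OF assms(1,2)])
  fix z u assume u: "u \<in> TS z"
  obtain y where y: "y \<in> TS z" "L z y = v z u" using u by (rule v_lift)
  have "u = L z y + h z u" by (simp add: y h_eq)
  moreover have "P z (L z y + h z u) = Q z (L z y + h z u)"
    using assms(3)[OF y(1)] assms(4)[OF u] u y(1)
    by (simp add: form_add[OF assms(1)] form_add[OF assms(2)] form_TS[OF L_form] h_TS)
  ultimately show "P z u = Q z u" by simp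
qed

lemma combination_ex1:
  "\<exists>!P. vector_one_form A P \<and> (\<forall>z. \<forall>u\<in>TS z. P z (L z u) = c *\<^sub>R h z u \<and> P z (h z u) = L z u)"
proof (rule ex_ex1I)
  show "\<exists>P. vector_one_form A P \<and> (\<forall>z. \<forall>u\<in>TS z. P z (L z u) = c *\<^sub>R h z u \<and> P z (h z u) = L z u)"
    \<comment> \<open>The witness is \<open>L + c J\<close>: on \<open>L u\<close> the first term
      vanishes and the second gives \<open>c h u\<close>; on \<open>h u\<close> the first gives
      \<open>L u\<close> and the second vanishes.\<close>
    by (intro exI[of _ "\<lambda>z u. L z u + c *\<^sub>R J z u"])
      (simp add: form_combine[OF L_form J_form] J_L J_h L_L L_h)
  show "P = Q"
    if "vector_one_form A P \<and> (\<forall>z. \<forall>u\<in>TS z. P z (L z u) = c *\<^sub>R h z u \<and> P z (h z u) = L z u)"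
      and "vector_one_form A Q \<and> (\<forall>z. \<forall>u\<in>TS z. Q z (L z u) = c *\<^sub>R h z u \<and> Q z (h z u) = L z u)" for P Q
    by (rule form_unique) (use that in auto)
qed

lemma G_ex1: "\<exists>!G. is_G A L C D G"
  unfolding is_G_iff by (rule combination_ex1)

lemma H_ex1: "\<exists>!H. is_H A L C D H"
  unfolding is_H_iff by (rule combination_ex1)

text \<open>On the image of \<open>L\<close>, \<open>H G\<close> acts as
  \<open>H (- h u) = - L u\<close>; on the image of \<open>h\<close>, as
  \<open>H (L u) = h u\<close>. The identity \<open>L (H G) = L\<close> is tested on these two
  images, both sides being 0 on the first.\<close>

lemma L_connection_comp:
  assumes "is_G A L C D G" "is_H A L C D H"
  shows "L_connection A L (H \<odot> G)"
proof -
  have G: "vector_one_form A G" "\<And>z u. u \<in> TS z \<Longrightarrow> G z (L z u) = - h z u"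
      "\<And>z u. u \<in> TS z \<Longrightarrow> G z (h z u) = L z u"
    and H: "vector_one_form A H" "\<And>z u. u \<in> TS z \<Longrightarrow> H z (L z u) = h z u"
      "\<And>z u. u \<in> TS z \<Longrightarrow> H z (h z u) = L z u"
    using assms unfolding is_G_iff is_H_iff by auto
  have HG: "vector_one_form A (H \<odot> G)" by (rule form_comp_form[OF H(1) G(1)])
  have HG_L: "(H \<odot> G) z (L z u) = - L z u" if "u \<in> TS z" for z u
    using that by (simp add: form_comp_def G H form_neg[OF H(1)] h_TS)
  have "L \<odot> (H \<odot> G) = L"
  proof (rule form_unique[OF form_comp_form[OF L_form HG] L_form])
    show "(L \<odot> (H \<odot> G)) z (L z u) = L z (L z u)" if "u \<in> TS z" for z u
      using HG_L[OF that] that unfolding form_comp_def[of L]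
      by (simp add: form_neg[OF L_form] form_TS[OF L_form] L_L)
    show "(L \<odot> (H \<odot> G)) z (h z u) = L z (h z u)" if "u \<in> TS z" for z u
      using that by (simp add: form_comp_def G H)
  qed
  moreover have "(H \<odot> G) \<odot> L = - L"
  proof (intro ext[of "(H \<odot> G) \<odot> L"] ext[of "((H \<odot> G) \<odot> L) _"])
    fix z u
    \<comment> \<open>Off the tangent space both sides are 0, because \<open>L z u = 0\<close> there
      and \<open>H G\<close> fixes 0.\<close>
    have "((H \<odot> G) \<odot> L) z u = - L z u"
      using HG_L[of u z] form_outside[OF L_form, of u z] form_0[OF HG, of z]
      by (cases "u \<in> TS z") (simp_all add: form_comp_def)
    then show "((H \<odot> G) \<odot> L) z u = (- L) z u"
      by (simp add: uminus_apply[of L] uminus_apply[of "L z"])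
  qed
  ultimately show ?thesis using HG by (simp add: L_connection_def)
qed

end

theorem theorem2p9:
  fixes A :: "('m::{t2_space, second_countable_topology}, 'e::euclidean_space) atlas"
    and n :: nat
    and L :: "'m form1"
    and C :: "'m field"
    and D :: "'m field \<Rightarrow> 'm field \<Rightarrow> 'm field"
  assumes "smooth_manifold A"
    and "DIM('e) = 2 * n"
    and "almost_tangent_structure A n L"
    and "canonical_field A L C"
    and "L_regular A L C D"
  shows "(\<exists>!G. is_G A L C D G) \<and> (\<exists>!H. is_H A L C D H) \<and>
    (\<exists>!\<Gamma>. L_connection A L \<Gamma> \<and> (\<exists>G H. is_G A L C D G \<and> is_H A L C D H \<and> \<Gamma> = H \<odot> G))"
proof -
  interpret regular_connection A n L C D
    using assms by unfold_locales
  obtain G H where GH: "is_G A L C D G" "is_H A L C D H" using G_ex1 H_ex1 by blast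
  have "G' = G" if "is_G A L C D G'" for G' using G_ex1 GH(1) that by blast
  moreover have "H' = H" if "is_H A L C D H'" for H' using H_ex1 GH(2) that by blast
  \<comment> \<open>Uniqueness of the composite is inherited from that of its two factors.\<close>
  ultimately have "\<exists>!\<Gamma>. L_connection A L \<Gamma> \<and>
      (\<exists>G H. is_G A L C D G \<and> is_H A L C D H \<and> \<Gamma> = H \<odot> G)"
    using L_connection_comp[OF GH] GH by (intro ex1I[of _ "H \<odot> G"]) blast+
  then show ?thesis using G_ex1 H_ex1 by blast
qed

end
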